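(* Let $d>2$, let $\Omega\subseteq\mathbb{R}^d$ be open, and let $2\le k\le d-1$, $p\ge 1$. Let $f\in W^{1,p}(\Omega,\mathbb{R}^d)$ and suppose that either $\det df>0$ a.e. or $\det df<0$ a.e. in $\Omega$, and that the a.e.-defined map $x\mapsto\bigwedge^k df_x\in\operatorname{End}(\bigwedge^k\mathbb{R}^d)$ has a smooth representative. If $k,d$ are not both even, then there is an open subset $\Omega_0\subseteq\Omega$ with $|\Omega\setminus\Omega_0|=0$ such that $f|_{\Omega_0}$ is smooth. If $k$ is odd, it suffices to assume $\det df\neq 0$ a.e. instead of the sign condition.
   Context: For a linear map $A:\mathbb{R}^d\to\mathbb{R}^d$, $\bigwedge^k A$ is the endomorphism of $\bigwedge^k\mathbb{R}^d$ defined by $v_1\wedge\dots\wedge v_k\mapsto Av_1\wedge\dots\wedge Av_k$ (encoding the $k$-minors of $A$). $df$ denotes the weak differential of $f$. *)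

theory Defs
  imports "HOL-Analysis.Analysis" "HOL-Combinatorics.Permutations"
begin

fun Cm_on :: "nat \<Rightarrow> (real^'n) set \<Rightarrow> (real^'n \<Rightarrow> real) \<Rightarrow> bool" where
  "Cm_on 0 U g = continuous_on U g"
| "Cm_on (Suc m) U g = (g differentiable_on U \<and>
     (\<forall>j. Cm_on m U (\<lambda>x. frechet_derivative g (at x) (axis j 1))))"

definition smooth_on :: "(real^'n) set \<Rightarrow> (real^'n \<Rightarrow> real) \<Rightarrow> bool" where
  "smooth_on U g \<longleftrightarrow> (\<forall>m. Cm_on m U g)"

definition test_function :: "(real^'n) set \<Rightarrow> (real^'n \<Rightarrow> real) \<Rightarrow> bool" where
  "test_function \<Omega> \<phi> \<longleftrightarrow> smooth_on UNIV \<phi> \<and>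
     (\<exists>K. compact K \<and> K \<subseteq> \<Omega> \<and> (\<forall>x. x \<notin> K \<longrightarrow> \<phi> x = 0))"

definition Lp_on :: "real \<Rightarrow> (real^'n) set \<Rightarrow> (real^'n \<Rightarrow> real) \<Rightarrow> bool" where
  "Lp_on p \<Omega> g \<longleftrightarrow> g \<in> borel_measurable (lebesgue_on \<Omega>) \<and>
     integrable (lebesgue_on \<Omega>) (\<lambda>x. \<bar>g x\<bar> powr p)"

definition weak_differential ::
  "(real^'n) set \<Rightarrow> (real^'n \<Rightarrow> real^'n) \<Rightarrow> (real^'n \<Rightarrow> real^'n^'n) \<Rightarrow> bool" where
  "weak_differential \<Omega> f Df \<longleftrightarrow>
     (\<forall>\<phi>. test_function \<Omega> \<phi> \<longrightarrow> (\<forall>i j.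
        integral\<^sup>L (lebesgue_on \<Omega>) (\<lambda>x. f x $ i * frechet_derivative \<phi> (at x) (axis j 1))
        = - integral\<^sup>L (lebesgue_on \<Omega>) (\<lambda>x. Df x $ i $ j * \<phi> x)))"

definition sobolev_W1p ::
  "real \<Rightarrow> (real^'n) set \<Rightarrow> (real^'n \<Rightarrow> real^'n) \<Rightarrow> (real^'n \<Rightarrow> real^'n^'n) \<Rightarrow> bool" where
  "sobolev_W1p p \<Omega> f Df \<longleftrightarrow> (\<forall>i. Lp_on p \<Omega> (\<lambda>x. f x $ i)) \<and>
     (\<forall>i j. Lp_on p \<Omega> (\<lambda>x. Df x $ i $ j)) \<and> weak_differential \<Omega> f Df"

text \<open>Matrix entries of the k-th exterior power of A with respect to the basis
  e_{r 0} \<and> ... \<and> e_{r (k-1)}: the k x k minor with rows r and columns c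
  (Leibniz formula). These encode all k-minors of A, hence determine wedge^k A.\<close>
definition kminor :: "nat \<Rightarrow> real^'n^'n \<Rightarrow> (nat \<Rightarrow> 'n) \<Rightarrow> (nat \<Rightarrow> 'n) \<Rightarrow> real" where
  "kminor k A r c = (\<Sum>\<pi> | \<pi> permutes {..<k}. of_int (sign \<pi>) * (\<Prod>a<k. A $ r a $ c (\<pi> a)))"

end

theory Submission
  imports Defs "Jordan_Normal_Form.Determinant"
begin

text \<open>
  Let \<open>M\<close> be a nonsingular submatrix of \<open>A = df\<close> of size \<open>k + 1\<close>. Its adjugate \<open>N\<close> has \<open>k\<close>-minors of \<open>A\<close>
  as entries, \<open>det N = (det M)^k\<close> and \<open>M = det M \<cdot> N\<inverse>\<close>. By Cramer's rule, all entries of \<open>A\<close> in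
  the rows of \<open>M\<close> are \<open>det M\<close> times rational functions of the \<open>k\<close>-minors of \<open>A\<close>. Letting the rows vary
  around one common row gives, near almost every point, \<open>df = \<tau> \<cdot> S\<close> with \<open>S\<close> and \<open>\<tau>^k\<close> smooth
  and nonvanishing. The sign of \<open>\<tau>\<close> is locally constant: for odd \<open>k\<close> it is that of \<open>\<tau>^k\<close>, for
  odd \<open>d\<close> it is determined by \<open>det df = \<tau>^d det S\<close>. Hence \<open>df\<close> agrees a.e. with a locally smooth
  function on an open set of full measure, and mollification shows that \<open>f\<close> is a.e. equal to a
  function whose classical differential is that function.
\<close>

hide_const (open) Determinant.det Matrix.row Matrix.vec_index Matrix.mat Matrix.vec
hide_type (open) Matrix.vec
hide_fact (open) Matrix.vec_eq_iff Matrix.mat_def Matrix.row_def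
no_notation Matrix.vec_index (infixl \<open>$\<close> 100)
no_notation Matrix.scalar_prod (infix \<open>\<bullet>\<close> 70)

section \<open>Recovering a matrix from its minors\<close>

text \<open>For even \<open>k\<close> the matrices \<open>A\<close> and \<open>-A\<close> have the
  same \<open>k\<close>-minors, so the minors recover \<open>A\<close> only up to sign, and a merely
  measurable \<open>df\<close> could switch that sign from point to point. The determinant
  hypothesis rules this out, but not when \<open>k\<close> and \<open>d\<close> are both even, since
  then \<open>det (-A) = det A\<close> too. Size \<open>k + 1\<close> is the one at which
  \<open>k\<close>-minors are the entries of an adjugate, and \<open>k \<le> d - 1\<close> provides
  such submatrices. Different submatrices bring different unknown determinants, of which only the
  \<open>k\<close>-th powers are known; comparing them through one entry of a common row leaves a
  single unknown scalar instead of many independent roots. The exceptional set appears because the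
  smooth representative need not consist of the minors of a nonsingular matrix at every point.
  Recovery therefore starts at a point where it does, and is then stated nearby for every matrix
  with the given minors, since \<open>df\<close> is tied to them only almost everywhere.\<close>

definition submat :: "nat \<Rightarrow> real^'n^'n \<Rightarrow> (nat \<Rightarrow> 'n) \<Rightarrow> (nat \<Rightarrow> 'n) \<Rightarrow> real mat" where
  "submat m A r c = Matrix.mat m m (\<lambda>(a,b). A $ r a $ c b)"

text \<open>The adjugate as a formula in an arbitrary \<open>G\<close>, so that the smooth
  representative can be inserted for the minors. Entry \<open>(a,b)\<close> omits row
  \<open>b\<close> and column \<open>a\<close>: \<open>insert_index b\<close> enumerates the indices
  other than \<open>b\<close>.\<close>

definition adj_minors ::
  "nat \<Rightarrow> ((nat \<Rightarrow> 'n) \<Rightarrow> (nat \<Rightarrow> 'n) \<Rightarrow> real) \<Rightarrow> (nat \<Rightarrow> 'n) \<Rightarrow> (nat \<Rightarrow> 'n) \<Rightarrow> real mat" where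
  "adj_minors m G r c =
     Matrix.mat m m (\<lambda>(a,b). (-1)^(a+b) * G (r \<circ> insert_index b) (c \<circ> insert_index a))"

lemma submat_carrier [simp]: "submat m A r c \<in> carrier_mat m m"
  by (simp add: submat_def)

lemma submat_index: "a < m \<Longrightarrow> b < m \<Longrightarrow> submat m A r c $$ (a,b) = A $ r a $ c b"
  by (simp add: submat_def)

lemma adj_minors_carrier [simp]: "adj_minors m G r c \<in> carrier_mat m m"
  by (simp add: adj_minors_def)

lemma kminor_eq_det: "kminor k A r c = Determinant.det (submat k A r c)"
proof -
  have "Determinant.det (submat k A r c)
      = (\<Sum>\<pi> | \<pi> permutes {0..<k}. of_int (sign \<pi>) * (\<Prod>a = 0..<k. submat k A r c $$ (a, \<pi> a)))"
    by (rule det_def') simp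
  also have "\<dots> = (\<Sum>\<pi> | \<pi> permutes {0..<k}. of_int (sign \<pi>) * (\<Prod>a = 0..<k. A $ r a $ c (\<pi> a)))"
  proof (intro sum.cong refl arg_cong2[where f="(*)"] prod.cong)
    fix \<pi> a assume "\<pi> \<in> {\<pi>. \<pi> permutes {0..<k}}" "a \<in> {0..<k}"
    then have "\<pi> a \<in> {0..<k}" by (simp only: mem_Collect_eq permutes_in_image)
    then show "submat k A r c $$ (a, \<pi> a) = A $ r a $ c (\<pi> a)"
      using \<open>a \<in> {0..<k}\<close> by (simp add: submat_index)
  qed
  finally show ?thesis by (simp add: kminor_def atLeast0LessThan)
qed

lemma adj_submat: "adj_mat (submat (Suc k) A r c) = adj_minors (Suc k) (kminor k A) r c"
proof (rule eq_matI)
  fix a b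
  assume "a < dim_row (adj_minors (Suc k) (kminor k A) r c)" "b < dim_col (adj_minors (Suc k) (kminor k A) r c)"
  then have ab: "a < Suc k" "b < Suc k" by (simp_all add: adj_minors_def)
  have "mat_delete (submat (Suc k) A r c) b a = submat k A (r \<circ> insert_index b) (c \<circ> insert_index a)"
    by (rule eq_matI) (use ab in \<open>auto simp: mat_delete_def submat_def insert_index_def\<close>)
  then show "adj_mat (submat (Suc k) A r c) $$ (a,b) = adj_minors (Suc k) (kminor k A) r c $$ (a,b)"
    using ab by (simp add: adj_mat_def adj_minors_def submat_def cofactor_def kminor_eq_det add.commute)
qed (simp_all add: adj_mat_def adj_minors_def submat_def)

section \<open>Determinant and adjugate of an adjugate\<close>

lemma mult_index_sum:
  assumes "A \<in> carrier_mat n n" "B \<in> carrier_mat n n" "i < n" "j < n"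
  shows "(A * B) $$ (i,j) = (\<Sum>l<n. A $$ (i,l) * B $$ (l,j))"
  using assms by (auto simp: scalar_prod_def atLeast0LessThan intro!: sum.cong)

text \<open>Taking determinants in \<open>M * adj_mat M = det M \<cdot> 1\<close> yields the power
  \<open>k + 1\<close>; one factor \<open>det M\<close> cancels because it is nonzero.\<close>

lemma det_adj_mat:
  fixes M :: "real mat"
  assumes M: "M \<in> carrier_mat (Suc k) (Suc k)" and nz: "Determinant.det M \<noteq> 0"
  shows "Determinant.det (adj_mat M) = Determinant.det M ^ k"
proof -
  note adj = adj_mat[OF M]
  have "Determinant.det M * Determinant.det (adj_mat M) = Determinant.det (Determinant.det M \<cdot>\<^sub>m 1\<^sub>m (Suc k))"
    by (simp only: det_mult[OF M adj(1), symmetric] adj(2))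
  also have "\<dots> = Determinant.det M * Determinant.det M ^ k" by simp
  finally show ?thesis using nz by simp
qed

text \<open>The two ways of associating \<open>M * adj_mat M * adj_mat (adj_mat M)\<close> give the
  two sides. The identity is kept free of division because it is later applied to a singular
  \<open>M\<close> as well, in order to refute that case.\<close>

lemma adj_adj_mat:
  fixes M :: "real mat"
  assumes M: "M \<in> carrier_mat n n" and ij: "i < n" "j < n"
  shows "M $$ (i,j) * Determinant.det (adj_mat M) = Determinant.det M * adj_mat (adj_mat M) $$ (i,j)"
proof -
  note adj = adj_mat[OF M]
  note adj2 = adj_mat[OF adj(1)]
  let ?t = "Determinant.det M" and ?d = "Determinant.det (adj_mat M)"
  have "M * (adj_mat M * adj_mat (adj_mat M)) = ?d \<cdot>\<^sub>m M"
    unfolding adj2(2) using M by (simp add: mult_smult_distrib[of _ n n _ n])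
  moreover have "M * (adj_mat M * adj_mat (adj_mat M)) = ?t \<cdot>\<^sub>m adj_mat (adj_mat M)"
    using assoc_mult_mat[OF M adj(1) adj2(1)] adj(2) adj2(1)
    by (simp add: mult_smult_assoc_mat[of _ n n _ n])
  ultimately have "?d \<cdot>\<^sub>m M = ?t \<cdot>\<^sub>m adj_mat (adj_mat M)" by simp
  then have "(?d \<cdot>\<^sub>m M) $$ (i,j) = (?t \<cdot>\<^sub>m adj_mat (adj_mat M)) $$ (i,j)" by simp
  then show ?thesis using M adj2(1) ij by (simp add: mult.commute)
qed

text \<open>Let \<open>t = det M\<close>, \<open>N = adj_mat M\<close>, \<open>d = det N\<close> and
  \<open>L = adj_mat N\<close>, so that \<open>M = (t / d) \<cdot> L\<close>. The inner sum is
  \<open>d / t\<close> times the determinant of \<open>M\<close> with column \<open>b\<close>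
  replaced by column \<open>j\<close> of \<open>A\<close>. Each term of Cramer's rule is an entry of
  \<open>M\<close> times such a determinant, divided by \<open>t\<close>; the two factors
  \<open>t / d\<close> leave \<open>t / d^2\<close>, hence the square.\<close>

definition row_factor ::
  "nat \<Rightarrow> ((nat \<Rightarrow> 'n) \<Rightarrow> (nat \<Rightarrow> 'n) \<Rightarrow> real) \<Rightarrow> (nat \<Rightarrow> 'n) \<Rightarrow> (nat \<Rightarrow> 'n) \<Rightarrow> nat \<Rightarrow> 'n \<Rightarrow> real" where
  "row_factor m G r c i j =
     (\<Sum>b<m. adj_mat (adj_minors m G r c) $$ (i,b) *
        (let a = (if b = 0 then 1 else 0) in
         \<Sum>l<m. adj_minors m G r (c(b := j)) $$ (a,l) * adj_mat (adj_minors m G r c) $$ (l,a)))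
     / (Determinant.det (adj_minors m G r c))\<^sup>2"

text \<open>Cramer's rule expresses the new column \<open>v\<close> through the determinants of the matrices \<open>M'\<close> in
  which \<open>v\<close> replaces column \<open>b\<close> of \<open>M\<close>; each \<open>det M'\<close> is a row of the adjugate of \<open>M'\<close> times a column
  which \<open>M'\<close> still shares with \<open>M\<close>.\<close>
lemma entry_eq_row_factor:
  fixes A :: "real^'n^'n"
  assumes k: "1 \<le> k" and i: "i < Suc k"
    and nz: "Determinant.det (submat (Suc k) A r c) \<noteq> 0"
  shows "A $ r i $ j = Determinant.det (submat (Suc k) A r c) * row_factor (Suc k) (kminor k A) r c i j"
proof -
  define m where "m = Suc k"
  define M where "M = submat m A r c"
  define t where "t = Determinant.det M"
  define N where "N = adj_minors m (kminor k A) r c"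
  define L where "L = adj_mat N"
  define d where "d = Determinant.det N"
  have M: "M \<in> carrier_mat m m" by (simp add: M_def)
  have NM: "N = adj_mat M" by (simp add: N_def M_def m_def adj_submat)
  have N: "N \<in> carrier_mat m m" by (simp add: N_def)
  have dt: "d = t ^ k" unfolding d_def NM t_def
    by (rule det_adj_mat) (use M nz in \<open>simp_all add: m_def M_def\<close>)
  have t0: "t \<noteq> 0" using nz by (simp add: t_def M_def m_def)
  have d0: "d \<noteq> 0" using dt t0 by simp
  have scaled: "M $$ (a,b) * d = t * L $$ (a,b)" if "a < m" "b < m" for a b
    using adj_adj_mat[OF M that] by (simp add: d_def L_def NM t_def)
  define v where "v l = A $ r l $ j" for l
  define M' where "M' b = submat m A r (c(b := j))" for b
  define N' where "N' b = adj_minors m (kminor k A) r (c(b := j))" for b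
  have M': "M' b \<in> carrier_mat m m" for b by (simp add: M'_def)
  have N'M: "N' b = adj_mat (M' b)" for b by (simp add: N'_def M'_def m_def adj_submat)
  have N': "N' b \<in> carrier_mat m m" for b by (simp add: N'_def)
  \<comment> \<open>Row \<open>b\<close> of an adjugate is formed with column \<open>b\<close>
    deleted, so it is the same for \<open>M\<close> and \<open>M' b\<close>. Its product with the
    new column \<open>v\<close> is a diagonal entry of \<open>adj_mat (M' b) * M' b\<close>.\<close>
  have A1: "(\<Sum>l<m. N $$ (b,l) * v l) = Determinant.det (M' b)" if b: "b < m" for b
  proof -
    have "Determinant.det (M' b) = (N' b * M' b) $$ (b,b)"
      using adj_mat(3)[OF M', of b] b by (simp add: N'M)
    also have "\<dots> = (\<Sum>l<m. N' b $$ (b,l) * M' b $$ (l,b))"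
      by (rule mult_index_sum[OF N' M' b b])
    also have "\<dots> = (\<Sum>l<m. N $$ (b,l) * v l)"
    proof (intro sum.cong refl arg_cong2[where f="(*)"])
      fix l assume "l \<in> {..<m}"
      moreover have "c(b := j) \<circ> insert_index b = c \<circ> insert_index b"
        by (auto simp: fun_eq_iff insert_index_def)
      ultimately show "N' b $$ (b,l) = N $$ (b,l)" using b by (simp add: N'_def N_def adj_minors_def)
      show "M' b $$ (l,b) = v l" using b \<open>l \<in> _\<close> by (simp add: M'_def v_def submat_index)
    qed
    finally show ?thesis by simp
  qed
  have A2: "d * Determinant.det (M' b) = t * (let a = (if b = 0 then 1 else 0) in \<Sum>l<m. N' b $$ (a,l) * L $$ (l,a))"
    if b: "b < m" for b
  proof -
    \<comment> \<open>Any index other than \<open>b\<close> would serve; this one is below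
      \<open>m = Suc k\<close> because \<open>k \<ge> 1\<close>.\<close>
    define a :: nat where "a = (if b = 0 then 1 else 0)"
    have a: "a < m" "a \<noteq> b" using k by (auto simp: a_def m_def)
    have "Determinant.det (M' b) = (N' b * M' b) $$ (a,a)"
      using adj_mat(3)[OF M', of b] a by (simp add: N'M)
    also have "\<dots> = (\<Sum>l<m. N' b $$ (a,l) * M' b $$ (l,a))"
      by (rule mult_index_sum[OF N' M' a(1) a(1)])
    also have "\<dots> = (\<Sum>l<m. N' b $$ (a,l) * M $$ (l,a))"
      using a by (intro sum.cong refl) (simp add: M'_def M_def submat_index)
    finally have "d * Determinant.det (M' b) = (\<Sum>l<m. N' b $$ (a,l) * (M $$ (l,a) * d))"
      by (simp add: sum_distrib_left mult_ac)
    also have "\<dots> = (\<Sum>l<m. N' b $$ (a,l) * (t * L $$ (l,a)))"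
      using a by (intro sum.cong refl) (simp add: scaled)
    finally show ?thesis by (simp add: a_def Let_def sum_distrib_left mult_ac)
  qed
  have im: "i < m" using i by (simp add: m_def)
  \<comment> \<open>Row \<open>i\<close> of \<open>M * N = t \<cdot> 1\<close>, applied to the
    vector \<open>v\<close>, with \<open>N v\<close> evaluated by \<open>A1\<close>.\<close>
  have A3: "t * v i = (\<Sum>b<m. M $$ (i,b) * Determinant.det (M' b))"
  proof -
    have MN: "(\<Sum>b<m. M $$ (i,b) * N $$ (b,l)) = (if i = l then t else 0)" if "l < m" for l
    proof -
      have "M * N = t \<cdot>\<^sub>m 1\<^sub>m m" using adj_mat(2)[OF M] by (simp add: NM t_def)
      then have "(M * N) $$ (i,l) = (t \<cdot>\<^sub>m 1\<^sub>m m) $$ (i,l)" by simp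
      then show ?thesis using that im unfolding mult_index_sum[OF M N im that] by simp
    qed
    have "(\<Sum>b<m. M $$ (i,b) * Determinant.det (M' b)) = (\<Sum>b<m. \<Sum>l<m. M $$ (i,b) * N $$ (b,l) * v l)"
      by (simp add: A1[symmetric] sum_distrib_left mult.assoc)
    also have "\<dots> = (\<Sum>l<m. \<Sum>b<m. M $$ (i,b) * N $$ (b,l) * v l)" by (rule sum.swap)
    also have "\<dots> = (\<Sum>l<m. (if i = l then t else 0) * v l)"
      by (intro sum.cong refl) (simp add: sum_distrib_right[symmetric] MN)
    also have "\<dots> = t * v i" using im by (simp add: if_distrib[of "\<lambda>x. x * _"] cong: if_cong)
    finally show ?thesis by simp
  qed
  define w where "w b = (let a = (if b = 0 then 1 else 0) in \<Sum>l<m. N' b $$ (a,l) * L $$ (l,a))" for b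
  have A2': "d * Determinant.det (M' b) = t * w b" if "b < m" for b
    unfolding w_def by (rule A2[OF that])
  define S where "S = (\<Sum>b<m. L $$ (i,b) * w b)"
  \<comment> \<open>One factor \<open>d\<close> for the entry of \<open>M\<close> and one for the
    determinant make both expressible through \<open>t\<close> and the minors. Of the resulting
    \<open>t * t\<close> one factor cancels.\<close>
  have "t * (v i * d\<^sup>2) = (\<Sum>b<m. M $$ (i,b) * Determinant.det (M' b)) * d\<^sup>2"
    by (simp only: A3[symmetric] mult.assoc)
  also have "\<dots> = (\<Sum>b<m. (M $$ (i,b) * d) * (d * Determinant.det (M' b)))"
    unfolding sum_distrib_right by (intro sum.cong refl) (simp add: power2_eq_square)
  also have "\<dots> = (\<Sum>b<m. (t * L $$ (i,b)) * (t * w b))"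
    using im by (intro sum.cong refl) (simp only: scaled A2' lessThan_iff)
  also have "\<dots> = t * (t * S)"
    unfolding S_def sum_distrib_left by (intro sum.cong refl) (simp add: mult_ac)
  finally have "v i * d\<^sup>2 = t * S" using t0 by simp
  then have "v i = t * (S / d\<^sup>2)" using d0 by (simp add: divide_simps)
  moreover have "row_factor (Suc k) (kminor k A) r c i j = S / d\<^sup>2"
    unfolding row_factor_def S_def w_def d_def L_def N_def N'_def m_def ..
  ultimately show ?thesis by (simp only: v_def t_def M_def m_def)
qed

text \<open>With \<open>B\<close> the inverse of \<open>A\<close>, the minor of
  \<open>A ** B\<close> with rows and columns \<open>r\<close> is 1. By multilinearity it is a
  combination of the minors of \<open>A\<close> with rows \<open>r\<close>, so these cannot all
  vanish.\<close>

lemma exists_nonzero_submat: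
  fixes A :: "real^'n^'n"
  assumes A: "det A \<noteq> 0" and r: "inj_on r {..<m}"
  shows "\<exists>c. Determinant.det (submat m A r c) \<noteq> 0"
proof (rule ccontr)
  assume "\<not> ?thesis"
  then have Z: "kminor m A r c = 0" for c by (simp add: kminor_eq_det)
  obtain B where AB: "A ** B = mat 1"
    using A invertible_det_nz[of A] unfolding invertible_def by auto
  have "submat m (mat 1) r r = 1\<^sub>m m"
    using r by (intro eq_matI) (auto simp: submat_def mat_def inj_on_def)
  then have "1 = kminor m (A ** B) r r" by (simp add: AB kminor_eq_det)
  also have "\<dots> = (\<Sum>\<pi> | \<pi> permutes {..<m}. of_int (sign \<pi>) *
      (\<Prod>a<m. \<Sum>s\<in>UNIV. A $ r a $ s * B $ s $ r (\<pi> a)))"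
    by (simp add: kminor_def matrix_matrix_mult_def)
  \<comment> \<open>Reindexing by the inverse of \<open>\<pi>\<close> frees the factors of
    \<open>B\<close> from \<open>\<pi>\<close>, so that they can be pulled out of the sum over
    permutations.\<close>
  also have "\<dots> = (\<Sum>\<pi> | \<pi> permutes {..<m}. of_int (sign \<pi>) *
      (\<Prod>a<m. \<Sum>s\<in>UNIV. A $ r (Hilbert_Choice.inv \<pi> a) $ s * B $ s $ r a))"
  proof (intro sum.cong refl arg_cong2[where f="(*)"])
    fix \<pi> assume "\<pi> \<in> {\<pi>. \<pi> permutes {..<m}}"
    then have p: "\<pi> permutes {..<m}" by simp
    show "(\<Prod>a<m. \<Sum>s\<in>UNIV. A $ r a $ s * B $ s $ r (\<pi> a))
        = (\<Prod>a<m. \<Sum>s\<in>UNIV. A $ r (Hilbert_Choice.inv \<pi> a) $ s * B $ s $ r a)"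
      using prod.permute[OF p, of "\<lambda>a. \<Sum>s\<in>UNIV. A $ r (Hilbert_Choice.inv \<pi> a) $ s * B $ s $ r a"]
      by (simp add: o_def permutes_inverses[OF p])
  qed
  \<comment> \<open>The product of sums is expanded over all maps \<open>s\<close> into the column
    indices, repetitions included; for each \<open>s\<close> the permutation sum reassembles to
    \<open>kminor m A r s\<close>.\<close>
  also have "\<dots> = (\<Sum>\<pi> | \<pi> permutes {..<m}. of_int (sign \<pi>) *
      (\<Sum>s\<in>{..<m} \<rightarrow>\<^sub>E UNIV. \<Prod>a<m. A $ r (Hilbert_Choice.inv \<pi> a) $ s a * B $ s a $ r a))"
    by (simp add: prod_sum_PiE)
  also have "\<dots> = (\<Sum>s\<in>{..<m} \<rightarrow>\<^sub>E UNIV. (\<Prod>a<m. B $ s a $ r a) * kminor m A r s)"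
  proof -
    have *: "(\<Prod>a<m. A $ r (Hilbert_Choice.inv \<pi> a) $ s a) = (\<Prod>a<m. A $ r a $ s (\<pi> a))"
      if p: "\<pi> permutes {..<m}" for \<pi> s
      using prod.permute[OF p, of "\<lambda>a. A $ r (Hilbert_Choice.inv \<pi> a) $ s a"]
      by (simp add: o_def permutes_inverses[OF p])
    have "(\<Sum>\<pi> | \<pi> permutes {..<m}. of_int (sign \<pi>) *
        (\<Sum>s\<in>{..<m} \<rightarrow>\<^sub>E UNIV. \<Prod>a<m. A $ r (Hilbert_Choice.inv \<pi> a) $ s a * B $ s a $ r a))
      = (\<Sum>\<pi> | \<pi> permutes {..<m}. \<Sum>s\<in>{..<m} \<rightarrow>\<^sub>E UNIV.
          (\<Prod>a<m. B $ s a $ r a) * (of_int (sign \<pi>) * (\<Prod>a<m. A $ r a $ s (\<pi> a))))"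
      by (intro sum.cong refl) (simp add: sum_distrib_left prod.distrib * mult_ac)
    also have "\<dots> = (\<Sum>s\<in>{..<m} \<rightarrow>\<^sub>E UNIV. (\<Prod>a<m. B $ s a $ r a) * kminor m A r s)"
      by (subst sum.swap) (simp add: kminor_def sum_distrib_left)
    finally show ?thesis .
  qed
  also have "\<dots> = 0" by (simp add: Z)
  finally show False by simp
qed

section \<open>Calculus of smooth functions\<close>

lemma has_derivative_of_Cm_on_Suc:
  assumes "open U" "Cm_on (Suc m) U g" "x \<in> U"
  shows "(g has_derivative frechet_derivative g (at x)) (at x)"
  using assms by (simp add: differentiable_on_eq_differentiable_at frechet_derivative_works[symmetric])

lemma Cm_on_cong:
  assumes U: "open U"
  shows "(\<And>x. x \<in> U \<Longrightarrow> g x = h x) \<Longrightarrow> Cm_on m U g \<Longrightarrow> Cm_on m U h"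
proof (induction m arbitrary: g h)
  case 0
  then show ?case by (simp cong: continuous_on_cong)
next
  case (Suc m)
  have D: "(h has_derivative frechet_derivative g (at x)) (at x)" if "x \<in> U" for x
    using has_derivative_transform_within_open[OF has_derivative_of_Cm_on_Suc[OF U Suc.prems(2) that] U that]
      Suc.prems(1) by blast
  have "Cm_on m U (\<lambda>x. frechet_derivative h (at x) (axis j 1))" for j
  proof (rule Suc.IH)
    show "Cm_on m U (\<lambda>x. frechet_derivative g (at x) (axis j 1))" using Suc.prems(2) by simp
  qed (simp add: frechet_derivative_at[OF D, symmetric])
  moreover have "h differentiable_on U"
    using D U by (meson differentiable_def differentiable_on_eq_differentiable_at)
  ultimately show ?case by simp
qed

text \<open>Lets any derivative \<open>D\<close> produced by the differentiation rules stand in for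
  \<open>frechet_derivative\<close>.\<close>

lemma Cm_on_SucI:
  assumes U: "open U" and D: "\<And>x. x \<in> U \<Longrightarrow> (g has_derivative D x) (at x)"
    and m: "\<And>j. Cm_on m U (\<lambda>x. D x (axis j 1))"
  shows "Cm_on (Suc m) U g"
proof -
  have "g differentiable_on U"
    using D U by (meson differentiable_def differentiable_on_eq_differentiable_at)
  moreover have "Cm_on m U (\<lambda>x. frechet_derivative g (at x) (axis j 1))" for j
    by (rule Cm_on_cong[OF U _ m]) (simp add: frechet_derivative_at[OF D, symmetric])
  ultimately show ?thesis by simp
qed

lemma Cm_on_SucD: "Cm_on (Suc m) U g \<Longrightarrow> Cm_on m U g"
proof (induction m arbitrary: g)
  case 0
  then show ?case by (simp add: differentiable_imp_continuous_on)
next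
  case (Suc m)
  from Suc.prems[unfolded Cm_on.simps(2)[of "Suc m"]] have 1: "g differentiable_on U"
    and 2: "\<And>j. Cm_on (Suc m) U (\<lambda>x. frechet_derivative g (at x) (axis j 1))"
    by blast+
  from Suc.IH[OF 2] 1 show ?case by (simp only: Cm_on.simps simp_thms)
qed

lemma Cm_on_subset:
  assumes V: "open V" and VU: "V \<subseteq> U"
  shows "Cm_on m U g \<Longrightarrow> Cm_on m V g"
proof (induction m arbitrary: g)
  case 0
  then show ?case using VU by (auto intro: continuous_on_subset)
next
  case (Suc m)
  then show ?case using VU by (auto intro: differentiable_on_subset)
qed

lemma Cm_on_const: "open U \<Longrightarrow> Cm_on m U (\<lambda>x. c)"
proof (induction m arbitrary: c)
  case (Suc m)
  show ?case by (rule Cm_on_SucI[where D="\<lambda>x h. 0"]) (use Suc in auto)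
qed simp

lemma Cm_on_add:
  assumes U: "open U"
  shows "Cm_on m U f \<Longrightarrow> Cm_on m U g \<Longrightarrow> Cm_on m U (\<lambda>x. f x + g x)"
proof (induction m arbitrary: f g)
  case 0
  then show ?case by (simp add: continuous_on_add)
next
  case (Suc m)
  show ?case
    by (rule Cm_on_SucI[OF U has_derivative_add[OF
          has_derivative_of_Cm_on_Suc[OF U Suc.prems(1)] has_derivative_of_Cm_on_Suc[OF U Suc.prems(2)]]])
      (use Suc in auto)
qed

lemma Cm_on_mult:
  assumes U: "open U"
  shows "Cm_on m U f \<Longrightarrow> Cm_on m U g \<Longrightarrow> Cm_on m U (\<lambda>x. f x * g x)"
proof (induction m arbitrary: f g)
  case 0
  then show ?case by (simp add: continuous_on_mult)
next
  case (Suc m)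
  have "Cm_on m U f" "Cm_on m U g"
    using Suc.prems by (simp_all only: Cm_on_SucD)
  then show ?case
    by (intro Cm_on_SucI[OF U has_derivative_mult[OF
          has_derivative_of_Cm_on_Suc[OF U Suc.prems(1)] has_derivative_of_Cm_on_Suc[OF U Suc.prems(2)]]]
        Cm_on_add[OF U] Suc.IH)
      (use Suc.prems in auto)
qed

text \<open>The chain rule produces a product of \<open>\<phi>'(g)\<close> with a partial derivative
  of \<open>g\<close>. If the family \<open>\<phi>\<close> is closed under differentiation up to
  linear combinations, the induction on \<open>m\<close> can run over all its members at once. Two
  summands are allowed because the derivative of \<open>exp (-1/t) / t ^ n\<close> has two
  terms.\<close>

lemma Cm_on_compose_family:
  fixes \<phi> :: "'i \<Rightarrow> real \<Rightarrow> real"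
  assumes U: "open U" and gT: "g ` U \<subseteq> T"
    and \<phi>: "\<And>i. \<exists>i1 i2 a b. \<forall>t\<in>T. (\<phi> i has_real_derivative a * \<phi> i1 t + b * \<phi> i2 t) (at t)"
  shows "Cm_on m U g \<Longrightarrow> Cm_on m U (\<lambda>x. \<phi> i (g x))"
proof (induction m arbitrary: i)
  case 0
  have "continuous_on T (\<phi> i)"
    using \<phi>[of i] by (meson DERIV_isCont continuous_at_imp_continuous_on)
  with 0 gT show ?case by (auto intro: continuous_on_compose2)
next
  case (Suc m)
  obtain i1 i2 a b where \<phi>': "\<And>t. t \<in> T \<Longrightarrow> (\<phi> i has_real_derivative a * \<phi> i1 t + b * \<phi> i2 t) (at t)"
    using \<phi>[of i] by blast
  have D: "((\<lambda>x. \<phi> i (g x)) has_derivative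
      (\<lambda>h. (a * \<phi> i1 (g x) + b * \<phi> i2 (g x)) * frechet_derivative g (at x) h)) (at x)" if "x \<in> U" for x
  proof -
    have "(\<phi> i has_derivative (*) (a * \<phi> i1 (g x) + b * \<phi> i2 (g x))) (at (g x))"
      using \<phi>'[of "g x"] gT that by (auto simp: has_field_derivative_def)
    from has_derivative_compose[OF has_derivative_of_Cm_on_Suc[OF U Suc.prems that] this]
    show ?thesis .
  qed
  have g: "Cm_on m U g" by (rule Cm_on_SucD[OF Suc.prems])
  show ?case
    by (rule Cm_on_SucI[OF U D])
      (use Suc.prems in \<open>auto intro!: Cm_on_mult Cm_on_add Cm_on_const U Suc.IH g\<close>)
qed

lemma smooth_on_subset: "smooth_on U g \<Longrightarrow> open V \<Longrightarrow> V \<subseteq> U \<Longrightarrow> smooth_on V g"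
  unfolding smooth_on_def by (blast intro: Cm_on_subset)

lemma smooth_on_cong: "open U \<Longrightarrow> smooth_on U g \<Longrightarrow> (\<And>x. x \<in> U \<Longrightarrow> g x = h x) \<Longrightarrow> smooth_on U h"
  unfolding smooth_on_def by (blast intro: Cm_on_cong)

lemma smooth_on_imp_continuous_on: "smooth_on U g \<Longrightarrow> continuous_on U g"
  unfolding smooth_on_def by (metis Cm_on.simps(1))

lemma smooth_on_has_derivative:
  "smooth_on U g \<Longrightarrow> open U \<Longrightarrow> x \<in> U \<Longrightarrow> (g has_derivative frechet_derivative g (at x)) (at x)"
  unfolding smooth_on_def by (blast intro: has_derivative_of_Cm_on_Suc)

lemma smooth_on_partial: "smooth_on U g \<Longrightarrow> smooth_on U (\<lambda>x. frechet_derivative g (at x) (axis j 1))"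
  unfolding smooth_on_def by (metis Cm_on.simps(2))

lemma smooth_onI:
  assumes "open U" "\<And>x. x \<in> U \<Longrightarrow> (g has_derivative D x) (at x)"
    and "\<And>j. smooth_on U (\<lambda>x. D x (axis j 1))"
  shows "smooth_on U g"
  unfolding smooth_on_def
proof
  fix m
  have "Cm_on (Suc m) U g"
    using assms by (intro Cm_on_SucI[of U g D]) (auto simp: smooth_on_def)
  then show "Cm_on m U g" by (rule Cm_on_SucD)
qed

lemma smooth_on_const: "open U \<Longrightarrow> smooth_on U (\<lambda>x. c)"
  by (simp add: smooth_on_def Cm_on_const)

lemma smooth_on_add: "open U \<Longrightarrow> smooth_on U f \<Longrightarrow> smooth_on U g \<Longrightarrow> smooth_on U (\<lambda>x. f x + g x)"
  by (simp add: smooth_on_def Cm_on_add)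

lemma smooth_on_mult: "open U \<Longrightarrow> smooth_on U f \<Longrightarrow> smooth_on U g \<Longrightarrow> smooth_on U (\<lambda>x. f x * g x)"
  by (simp add: smooth_on_def Cm_on_mult)

lemma smooth_on_sum: "open U \<Longrightarrow> (\<And>i. i \<in> I \<Longrightarrow> smooth_on U (f i)) \<Longrightarrow> smooth_on U (\<lambda>x. \<Sum>i\<in>I. f i x)"
  by (induction I rule: infinite_finite_induct) (auto intro: smooth_on_const smooth_on_add)

lemma smooth_on_prod: "open U \<Longrightarrow> (\<And>i. i \<in> I \<Longrightarrow> smooth_on U (f i)) \<Longrightarrow> smooth_on U (\<lambda>x. \<Prod>i\<in>I. f i x)"
  by (induction I rule: infinite_finite_induct) (auto intro: smooth_on_const smooth_on_mult)

lemma smooth_on_compose_family: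
  fixes \<phi> :: "'i \<Rightarrow> real \<Rightarrow> real"
  assumes "open U" "smooth_on U g" "g ` U \<subseteq> T"
    and "\<And>i. \<exists>i1 i2 a b. \<forall>t\<in>T. (\<phi> i has_real_derivative a * \<phi> i1 t + b * \<phi> i2 t) (at t)"
  shows "smooth_on U (\<lambda>x. \<phi> i (g x))"
  using assms Cm_on_compose_family[of U g T \<phi>] unfolding smooth_on_def by blast

lemma smooth_on_powr:
  assumes U: "open U" and g: "smooth_on U g" and pos: "\<And>x. x \<in> U \<Longrightarrow> g x > 0"
  shows "smooth_on U (\<lambda>x. g x powr a)"
proof (rule smooth_on_compose_family[OF U g, of "{0<..}" "\<lambda>a t. t powr a" a])
  show "\<exists>i1 i2 c b. \<forall>t\<in>{0<..}. ((\<lambda>t. t powr i) has_real_derivative c * t powr i1 + b * t powr i2) (at t)" for i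
    by (rule exI[of _ "i - 1"], rule exI[of _ "i - 1"], rule exI[of _ i], rule exI[of _ 0])
      (auto intro!: derivative_eq_intros)
qed (use pos in auto)

text \<open>The reciprocal is embedded in the family of its powers, which is closed under
  differentiation up to constants.\<close>

lemma smooth_on_inverse:
  assumes U: "open U" and g: "smooth_on U g" and nz: "\<And>x. x \<in> U \<Longrightarrow> g x \<noteq> 0"
  shows "smooth_on U (\<lambda>x. inverse (g x))"
proof -
  have "smooth_on U (\<lambda>x. inverse (g x) ^ 1)"
  proof (rule smooth_on_compose_family[OF U g, of "-{0}" "\<lambda>n t. inverse t ^ n" 1])
    fix n :: nat
    have "((\<lambda>t. inverse t ^ n) has_real_derivative - real n * inverse t ^ Suc n) (at t)" if "t \<noteq> 0" for t :: real
    proof -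
      have "((\<lambda>t. inverse t ^ n) has_real_derivative real n * inverse t ^ (n - 1) * - (inverse t ^ 2)) (at t)"
        using that by (auto intro!: derivative_eq_intros simp: power2_eq_square)
      moreover have "real n * inverse t ^ (n - 1) * - (inverse t ^ 2) = - real n * inverse t ^ Suc n"
        by (cases n) (simp_all add: power2_eq_square algebra_simps)
      ultimately show ?thesis by (simp only:)
    qed
    then show "\<exists>i1 i2 c b. \<forall>t\<in>-{0}. ((\<lambda>t::real. inverse t ^ n) has_real_derivative c * inverse t ^ i1 + b * inverse t ^ i2) (at t)"
      by (intro exI[of _ "Suc n"] exI[of _ "0::nat"] exI[of _ "- real n"] exI[of _ "0::real"]) simp
  qed (use nz in auto)
  then show ?thesis by simp
qed

lemma smooth_on_divide:
  "open U \<Longrightarrow> smooth_on U f \<Longrightarrow> smooth_on U g \<Longrightarrow> (\<And>x. x \<in> U \<Longrightarrow> g x \<noteq> 0) \<Longrightarrow> smooth_on U (\<lambda>x. f x / g x)"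
  unfolding divide_inverse by (intro smooth_on_mult smooth_on_inverse)

lemma smooth_on_power: "open U \<Longrightarrow> smooth_on U f \<Longrightarrow> smooth_on U (\<lambda>x. f x ^ n)"
  by (induction n) (auto intro: smooth_on_const smooth_on_mult)

lemma smooth_on_linear:
  assumes "open U" "bounded_linear f"
  shows "smooth_on U f"
  by (rule smooth_onI[where D="\<lambda>x. f"]) (auto intro: assms smooth_on_const bounded_linear_imp_has_derivative)

lemma smooth_on_local:
  assumes "\<And>x. x \<in> U \<Longrightarrow> \<exists>W. open W \<and> x \<in> W \<and> smooth_on W g"
  shows "smooth_on U g"
proof -
  have local: "Cm_on m U g" if "\<And>x. x \<in> U \<Longrightarrow> \<exists>W. open W \<and> x \<in> W \<and> Cm_on m W g" for m
    using that
  proof (induction m arbitrary: g)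
    case 0
    then have "isCont g x" if "x \<in> U" for x
      using that by (metis Cm_on.simps(1) continuous_on_eq_continuous_at)
    then show ?case by (simp add: continuous_at_imp_continuous_on)
  next
    case (Suc m)
    then have "g differentiable at x" if "x \<in> U" for x
      using that by (metis Cm_on.simps(2) differentiable_on_eq_differentiable_at)
    moreover have "Cm_on m U (\<lambda>x. frechet_derivative g (at x) (axis j 1))" for j
      by (rule Suc.IH) (metis Suc.prems Cm_on.simps(2))
    ultimately show ?case
      by (simp add: differentiable_at_withinI differentiable_on_def)
  qed
  show ?thesis
    unfolding smooth_on_def by (intro allI local) (metis assms smooth_on_def)
qed

subsection \<open>Bump functions\<close>

text \<open>\<open>flat 0\<close> is the classical smooth function that vanishes on the negative
  axis without being analytic at 0. The denominators \<open>t ^ n\<close> complete it to a family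
  closed under differentiation.\<close>

definition flat :: "nat \<Rightarrow> real \<Rightarrow> real" where
  "flat n t = (if t > 0 then exp (- (1/t)) / t ^ n else 0)"

text \<open>From the right, substituting \<open>1/t\<close> turns this into the decay of
  \<open>x ^ n / exp x\<close> at infinity.\<close>

lemma flat_tendsto_0: "(flat n \<longlongrightarrow> 0) (at 0)"
proof -
  have "((\<lambda>x. x ^ n / exp x) \<longlongrightarrow> (0::real)) at_top" by (rule tendsto_power_div_exp_0)
  from filterlim_compose[OF this filterlim_inverse_at_top_right]
  have "((\<lambda>t::real. inverse t ^ n / exp (inverse t)) \<longlongrightarrow> 0) (at_right 0)" .
  then have "(flat n \<longlongrightarrow> 0) (at_right 0)"
    by (rule Lim_transform_eventually)
      (auto simp: eventually_at_right_less flat_def exp_minus field_simps intro!: eventually_at_rightI[of 0 1])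
  moreover have "(flat n \<longlongrightarrow> 0) (at_left 0)"
    by (rule tendsto_eventually) (auto simp: flat_def intro!: eventually_at_leftI[of "-1"])
  ultimately show ?thesis by (simp add: filterlim_split_at)
qed

lemma flat_has_real_derivative:
  "(flat n has_real_derivative (- real n * flat (Suc n) t + 1 * flat (n + 2) t)) (at t)"
proof -
  consider "t > 0" | "t < 0" | "t = 0" by linarith
  then show ?thesis
  proof cases
    case 1
    have "((\<lambda>t. exp (- (1/t)) / t ^ n) has_real_derivative
        (exp (- (1/t)) * (1 / t^2) * t ^ n - exp (- (1/t)) * (real n * t ^ (n - 1))) / (t ^ n * t ^ n)) (at t)"
      using 1 by (auto intro!: derivative_eq_intros simp: power2_eq_square)
    moreover have "(exp (- (1/t)) * (1 / t^2) * t ^ n - exp (- (1/t)) * (real n * t ^ (n - 1))) / (t ^ n * t ^ n)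
        = - real n * flat (Suc n) t + 1 * flat (n + 2) t"
      using 1 by (cases n) (auto simp: flat_def field_simps power2_eq_square)
    ultimately have "((\<lambda>t. exp (- (1/t)) / t ^ n) has_real_derivative - real n * flat (Suc n) t + 1 * flat (n + 2) t) (at t)"
      by simp
    then show ?thesis
      by (rule has_field_derivative_transform_within_open[where S="{0<..}"]) (use 1 in \<open>auto simp: flat_def\<close>)
  next
    case 2
    have "((\<lambda>t. 0) has_real_derivative - real n * flat (Suc n) t + 1 * flat (n + 2) t) (at t)"
      using 2 by (simp add: flat_def)
    then show ?thesis
      by (rule has_field_derivative_transform_within_open[where S="{..<0}"]) (use 2 in \<open>auto simp: flat_def\<close>)
  next
    case 3
    \<comment> \<open>At 0 the difference quotient of \<open>flat n\<close> is the next member of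
      the family, so its limit is known. At \<open>h = 0\<close> both sides are 0 by the convention
      for division.\<close>
    have "flat (Suc n) = (\<lambda>h. (flat n (0 + h) - flat n 0) / h)"
      by (auto simp: flat_def fun_eq_iff)
    with flat_tendsto_0[of "Suc n"] have "(flat n has_real_derivative 0) (at 0)"
      by (simp add: DERIV_def)
    with 3 show ?thesis by (simp add: flat_def)
  qed
qed

lemma smooth_on_flat:
  assumes "open U" "smooth_on U g"
  shows "smooth_on U (\<lambda>x. flat n (g x))"
proof (rule smooth_on_compose_family[OF assms, of UNIV flat])
  show "\<exists>i1 i2 a b. \<forall>t\<in>UNIV. (flat i has_real_derivative a * flat i1 t + b * flat i2 t) (at t)" for i
    using flat_has_real_derivative[of i] by blast
qed simp

lemma flat_nonneg: "flat n t \<ge> 0" and flat_pos: "t > 0 \<Longrightarrow> flat n t > 0" and flat_0: "t \<le> 0 \<Longrightarrow> flat n t = 0"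
  by (auto simp: flat_def)

section \<open>Functions with a continuous weak gradient\<close>

lemma integrable_mult_bounded:
  fixes u k :: "'a::euclidean_space \<Rightarrow> real"
  assumes u: "integrable lborel u" and k: "k \<in> borel_measurable borel" and C: "\<And>x. \<bar>k x\<bar> \<le> C"
  shows "integrable lborel (\<lambda>x. u x * k x)"
proof (rule Bochner_Integration.integrable_bound)
  show "integrable lborel (\<lambda>x. C * \<bar>u x\<bar>)" using u by simp
  show "(\<lambda>x. u x * k x) \<in> borel_measurable lborel" using u k by (auto intro: borel_measurable_times)
  show "AE x in lborel. norm (u x * k x) \<le> norm (C * \<bar>u x\<bar>)"
  proof (rule AE_I2)
    fix x
    have "\<bar>u x\<bar> * \<bar>k x\<bar> \<le> \<bar>u x\<bar> * C" using C[of x] by (rule mult_left_mono) simp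
    moreover have "C \<ge> 0" using C[of x] by linarith
    ultimately show "norm (u x * k x) \<le> norm (C * \<bar>u x\<bar>)" by (simp add: abs_mult mult.commute)
  qed
qed

lemma integrable_indicator_cbox: "integrable lborel (indicator (cbox a b) :: 'a::euclidean_space \<Rightarrow> real)"
  by (simp add: integrable_indicator_iff emeasure_lborel_cbox_finite[unfolded infinity_ennreal_def])

lemma integrable_bounded_support:
  fixes g :: "'a::euclidean_space \<Rightarrow> real"
  assumes g: "g \<in> borel_measurable borel" "\<And>x. \<bar>g x\<bar> \<le> C"
    and S: "bounded S" "\<And>x. x \<notin> S \<Longrightarrow> g x = 0"
  shows "integrable lborel g"
proof -
  obtain a where a: "S \<subseteq> cbox (-a) a" using bounded_subset_cbox_symmetric[OF S(1)] by blast
  have "integrable lborel (\<lambda>x. indicator (cbox (-a) a) x * g x)"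
    by (rule integrable_mult_bounded[OF integrable_indicator_cbox g])
  moreover have "(\<lambda>x. indicator (cbox (-a) a) x * g x) = g"
    using S(2) a by (auto simp: fun_eq_iff indicator_def)
  ultimately show ?thesis by simp
qed

lemma bounded_of_bounded_support:
  fixes g :: "'a::euclidean_space \<Rightarrow> real"
  assumes g: "continuous_on UNIV g" and S: "bounded S" "\<And>x. x \<notin> S \<Longrightarrow> g x = 0"
  obtains C where "\<And>x. \<bar>g x\<bar> \<le> C"
proof -
  obtain a where a: "S \<subseteq> cbox (-a) a" using bounded_subset_cbox_symmetric[OF S(1)] by blast
  have "bounded (g ` cbox (-a) a)"
    using g by (intro compact_imp_bounded compact_continuous_image compact_cbox)
      (auto intro: continuous_on_subset)
  then obtain C where C: "\<And>x. x \<in> cbox (-a) a \<Longrightarrow> \<bar>g x\<bar> \<le> C"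
    unfolding bounded_iff by auto
  have "\<bar>g x\<bar> \<le> max C 0" for x
    using C[of x] S(2)[of x] a by (cases "x \<in> cbox (-a) a") fastforce+
  then show ?thesis by (rule that)
qed

lemma integrable_continuous_bounded_support:
  fixes g :: "'a::euclidean_space \<Rightarrow> real"
  assumes g: "continuous_on UNIV g" and S: "bounded S" "\<And>x. x \<notin> S \<Longrightarrow> g x = 0"
  shows "integrable lborel g"
proof -
  obtain C where "\<And>x. \<bar>g x\<bar> \<le> C" using bounded_of_bounded_support[OF g S] by blast
  then show ?thesis
    using integrable_bounded_support[OF borel_measurable_continuous_onI[OF g] _ S] by blast
qed

lemma integrable_mult_continuous_bounded_support:
  fixes u g :: "'a::euclidean_space \<Rightarrow> real"
  assumes u: "integrable lborel u"
    and g: "continuous_on UNIV g" and S: "bounded S" "\<And>x. x \<notin> S \<Longrightarrow> g x = 0"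
  shows "integrable lborel (\<lambda>x. u x * g x)"
proof -
  obtain C where "\<And>x. \<bar>g x\<bar> \<le> C" using bounded_of_bounded_support[OF g S] by blast
  then show ?thesis
    using integrable_mult_bounded[OF u borel_measurable_continuous_onI[OF g]] by blast
qed

lemma uniformly_continuous_on_bounded_support:
  fixes g :: "'a::euclidean_space \<Rightarrow> real"
  assumes g: "continuous_on UNIV g" and S: "bounded S" "\<And>x. x \<notin> S \<Longrightarrow> g x = 0"
  shows "uniformly_continuous_on UNIV g"
  unfolding uniformly_continuous_on_def
proof (intro allI impI)
  fix e :: real assume "e > 0"
  obtain r where r: "\<And>x. x \<in> S \<Longrightarrow> norm x \<le> r" using S(1) unfolding bounded_iff by blast
  \<comment> \<open>If one of two points at distance below 1 lies in \<open>S\<close>, both lie in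
    the ball of radius \<open>r + 1\<close>; otherwise \<open>g\<close> is 0 at both.\<close>
  have "uniformly_continuous_on (cball 0 (r + 1)) g"
    using g by (intro compact_uniformly_continuous compact_cball) (auto intro: continuous_on_subset)
  then obtain d where "d > 0" and d: "\<And>x y. norm x \<le> r + 1 \<Longrightarrow> norm y \<le> r + 1 \<Longrightarrow> dist y x < d \<Longrightarrow> dist (g y) (g x) < e"
    using \<open>e > 0\<close> unfolding uniformly_continuous_on_def by (auto simp: Ball_def)
  have "dist (g y) (g x) < e" if "dist y x < min d 1" for x y
  proof (cases "x \<in> S \<or> y \<in> S")
    case True
    have "norm x \<le> norm y + dist y x" "norm y \<le> norm x + dist y x"
      by (metis dist_commute dist_norm norm_triangle_sub)+
    with True r that show ?thesis by (intro d) force+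
  next
    case False
    with S(2) \<open>e > 0\<close> show ?thesis by simp
  qed
  with \<open>d > 0\<close> show "\<exists>d>0. \<forall>x\<in>UNIV. \<forall>x'\<in>UNIV. dist x' x < d \<longrightarrow> dist (g x') (g x) < e"
    by (intro exI[of _ "min d 1"]) auto
qed

text \<open>Boxes form an intersection-stable generator of the Borel sets, and the sets over which
  \<open>w\<close> integrates to 0 form a Dynkin system. Hence \<open>w\<close> has integral 0 over
  every Borel set.\<close>

lemma AE_zero_if_box_integrals_zero:
  fixes w :: "'a::euclidean_space \<Rightarrow> real"
  assumes w: "integrable lborel w"
    and box: "\<And>c d. (\<integral>x. indicator (box c d) x * w x \<partial>lborel) = 0"
  shows "AE x in lborel. w x = 0"
proof (rule sigma_finite_measure.density_zero[OF sigma_finite_lborel w])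
  let ?E = "range (\<lambda>(a, b). box a b::'a set)"
  have int: "set_integrable lborel A w" if "A \<in> sets lborel" for A
    unfolding set_integrable_def using w that by (intro integrable_mult_indicator) auto
  \<comment> \<open>Growing cubes exhaust the space. This total integral is what closes the system
    under complements.\<close>
  have all: "(\<integral>x. w x \<partial>lborel) = 0"
  proof -
    let ?A = "\<lambda>n::nat. box (- (real n *\<^sub>R One)) (real n *\<^sub>R One) :: 'a set"
    have "(\<lambda>n. \<integral>x. indicator (?A n) x * w x \<partial>lborel) \<longlonglongrightarrow> (\<integral>x. w x \<partial>lborel)"
    proof (rule integral_dominated_convergence[where w="\<lambda>x. \<bar>w x\<bar>"])
      show "AE x in lborel. (\<lambda>n. indicator (?A n) x * w x) \<longlonglongrightarrow> w x"
      proof (rule AE_I2, rule tendsto_eventually)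
        fix x :: 'a
        obtain N :: nat where N: "norm x < N" using reals_Archimedean2 by blast
        have "x \<in> ?A n" if "n \<ge> N" for n
        proof -
          have "\<bar>x \<bullet> i\<bar> < real n" if "i \<in> Basis" for i
            using Basis_le_norm[OF that, of x] N \<open>n \<ge> N\<close> by linarith
          then have "- real n < x \<bullet> i \<and> x \<bullet> i < real n" if "i \<in> Basis" for i
            using that by (simp add: abs_less_iff minus_less_iff)
          then show ?thesis by (auto simp: mem_box)
        qed
        then show "\<forall>\<^sub>F n in sequentially. indicator (?A n) x * w x = w x"
          unfolding eventually_sequentially by (intro exI[of _ N]) (simp add: indicator_def)
      qed
      show "AE x in lborel. norm (indicator (?A n) x * w x) \<le> \<bar>w x\<bar>" for n
        by (rule AE_I2) (simp add: indicator_def)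
    qed (use w in \<open>auto intro!: borel_measurable_times borel_measurable_indicator\<close>)
    then show ?thesis by (simp add: box LIMSEQ_const_iff)
  qed
  fix A :: "'a set"
  assume "A \<in> sets lborel"
  then have A: "A \<in> sigma_sets UNIV ?E" by (simp add: borel_eq_box)
  have "Int_stable ?E" by (auto simp: Int_stable_def box_Int_box)
  moreover have "?E \<subseteq> Pow UNIV" by simp
  ultimately show "set_lebesgue_integral lborel A w = 0"
    using A
  proof (induction rule: sigma_sets_induct_disjoint)
    fix A :: "'a set" assume "A \<in> ?E"
    then show "set_lebesgue_integral lborel A w = 0"
      using box by (auto simp: set_lebesgue_integral_def)
  next
    fix A :: "'a set" assume "A \<in> sigma_sets UNIV ?E" and A: "set_lebesgue_integral lborel A w = 0"
    then have "A \<in> sets lborel" by (simp add: borel_eq_box)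
    then have "set_lebesgue_integral lborel (A \<union> (UNIV - A)) w
        = set_lebesgue_integral lborel A w + set_lebesgue_integral lborel (UNIV - A) w"
      by (intro set_integral_Un int) auto
    then show "set_lebesgue_integral lborel (UNIV - A) w = 0"
      using all A by (simp add: set_lebesgue_integral_def Un_Diff_cancel)
  next
    fix A :: "nat \<Rightarrow> 'a set"
    assume A: "disjoint_family A" "range A \<subseteq> sigma_sets UNIV ?E"
      and 0: "\<And>i. set_lebesgue_integral lborel (A i) w = 0"
    have m: "A i \<in> sets lborel" for i using A(2) by (auto simp: borel_eq_box)
    have "set_lebesgue_integral lborel (\<Union>i. A i) w = (\<Sum>i. set_lebesgue_integral lborel (A i) w)"
      using m A(1) by (intro lebesgue_integral_countable_add int sets.countable_UN)
        (auto simp: disjoint_family_on_def)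
    then show "set_lebesgue_integral lborel (\<Union>i. A i) w = 0" by (simp add: 0)
  qed (auto simp: set_lebesgue_integral_def)
qed

text \<open>Each coordinate contributes one factor per face of the box. The scale \<open>s\<close>
  steepens the bump, which tends to the indicator of the open box as \<open>s\<close> grows.\<close>

definition box_bump :: "real \<Rightarrow> real^'n \<Rightarrow> real^'n \<Rightarrow> real^'n \<Rightarrow> real" where
  "box_bump s a b x = (\<Prod>i\<in>UNIV. flat 0 (s * (x $ i - a $ i)) * flat 0 (s * (b $ i - x $ i)))"

lemma smooth_on_box_bump:
  fixes a b :: "real^'n"
  shows "smooth_on UNIV (box_bump s a b)"
proof -
  have nth: "smooth_on UNIV (\<lambda>x::real^'n. x $ i)" for i
    by (intro smooth_on_linear open_UNIV bounded_linear_vec_nth)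
  have "smooth_on UNIV (\<lambda>x::real^'n. s * (x $ i + (- a $ i)))"
    "smooth_on UNIV (\<lambda>x::real^'n. s * (b $ i + (-1) * x $ i))" for i
    by (intro smooth_on_mult smooth_on_add smooth_on_const nth open_UNIV)+
  then show ?thesis
    unfolding box_bump_def by (intro smooth_on_prod smooth_on_mult[OF _ smooth_on_flat smooth_on_flat] open_UNIV) simp_all
qed

lemma box_bump_nonneg: "0 \<le> box_bump s a b x"
  unfolding box_bump_def by (intro prod_nonneg mult_nonneg_nonneg flat_nonneg ballI)

lemma flat_le_1: "flat 0 t \<le> 1"
  by (simp add: flat_def)

lemma box_bump_le_1: "box_bump s a b x \<le> 1"
  unfolding box_bump_def by (intro prod_le_1 conjI mult_nonneg_nonneg mult_le_one flat_nonneg flat_le_1)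

lemma box_bump_zero:
  assumes "s > 0" "x \<notin> box a b"
  shows "box_bump s a b x = 0"
proof -
  obtain i where "x $ i \<le> a $ i \<or> b $ i \<le> x $ i"
    using assms(2) by (auto simp: mem_box_cart not_less)
  then have "flat 0 (s * (x $ i - a $ i)) * flat 0 (s * (b $ i - x $ i)) = 0"
    using assms(1) by (auto simp: flat_0 mult_nonneg_nonpos)
  then show ?thesis unfolding box_bump_def by (intro prod_zero) auto
qed

lemma box_bump_pos: "s > 0 \<Longrightarrow> x \<in> box a b \<Longrightarrow> box_bump s a b x > 0"
  unfolding box_bump_def by (intro prod_pos mult_pos_pos flat_pos ballI) (auto simp: mem_box_cart)

lemma box_bump_tendsto_indicator: "(\<lambda>n. box_bump (real (Suc n)) a b x) \<longlonglongrightarrow> indicator (box a b) x"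
proof (cases "x \<in> box a b")
  case True
  have lim: "(\<lambda>n. flat 0 (real (Suc n) * t)) \<longlonglongrightarrow> 1" if "t > 0" for t
  proof -
    have "(\<lambda>n. exp (- (1 / t) * inverse (real (Suc n)))) \<longlonglongrightarrow> exp (- (1 / t) * 0)"
      by (intro tendsto_intros LIMSEQ_inverse_real_of_nat)
    then show ?thesis using that by (simp add: flat_def field_simps add_pos_nonneg)
  qed
  have "(\<lambda>n. box_bump (real (Suc n)) a b x) \<longlonglongrightarrow> (\<Prod>i\<in>(UNIV::'a set). 1 * 1)"
    unfolding box_bump_def using True by (intro tendsto_prod tendsto_mult lim) (auto simp: mem_box_cart)
  then show ?thesis using True by simp
qed (simp add: box_bump_zero)

text \<open>Steepening bumps are admissible test functions and converge to indicators under the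
  majorant \<open>\<bar>w\<bar>\<close>, so the integrals of \<open>w\<close> over boxes
  vanish.\<close>

lemma fundamental_lemma_box:
  fixes w :: "real^'n \<Rightarrow> real"
  assumes w: "integrable lborel w" and w0: "\<And>x. x \<notin> box a b \<Longrightarrow> w x = 0"
    and test: "\<And>\<phi>. smooth_on UNIV \<phi> \<Longrightarrow> (\<And>x. x \<notin> box a b \<Longrightarrow> \<phi> x = 0) \<Longrightarrow> (\<integral>x. w x * \<phi> x \<partial>lborel) = 0"
  shows "AE x in lborel. w x = 0"
proof (rule AE_zero_if_box_integrals_zero[OF w])
  fix c d :: "real^'n"
  \<comment> \<open>Corners of the intersection with \<open>box a b\<close>: the bumps must vanish
    outside that box, and \<open>w\<close> does so itself, hence nothing of the integral over
    \<open>box c d\<close> is lost.\<close>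
  define c' where "c' = (\<chi> i. max (a $ i) (c $ i))"
  define d' where "d' = (\<chi> i. min (b $ i) (d $ i))"
  have sub: "box c' d' = box a b \<inter> box c d"
    by (auto simp: c'_def d'_def mem_box_cart)
  have "(\<lambda>n. \<integral>x. w x * box_bump (real (Suc n)) c' d' x \<partial>lborel)
      \<longlonglongrightarrow> (\<integral>x. w x * indicator (box c' d') x \<partial>lborel)"
  proof (rule integral_dominated_convergence[where w="\<lambda>x. \<bar>w x\<bar>"])
    show "AE x in lborel. (\<lambda>n. w x * box_bump (real (Suc n)) c' d' x) \<longlonglongrightarrow> w x * indicator (box c' d') x"
      by (intro AE_I2 tendsto_mult tendsto_const box_bump_tendsto_indicator)
    show "AE x in lborel. norm (w x * box_bump (real (Suc n)) c' d' x) \<le> \<bar>w x\<bar>" for n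
      by (rule AE_I2) (simp add: abs_mult box_bump_nonneg box_bump_le_1 mult_left_le)
    show "(\<lambda>x. w x * box_bump (real (Suc n)) c' d' x) \<in> borel_measurable lborel" for n
      using w borel_measurable_continuous_onI[OF smooth_on_imp_continuous_on[OF smooth_on_box_bump]]
      by (intro borel_measurable_times) auto
  qed (use w in \<open>auto intro!: borel_measurable_times borel_measurable_indicator\<close>)
  moreover have "(\<integral>x. w x * box_bump (real (Suc n)) c' d' x \<partial>lborel) = 0" for n
    by (rule test[OF smooth_on_box_bump]) (simp add: box_bump_zero sub)
  moreover have "(\<lambda>x. w x * indicator (box c' d') x) = (\<lambda>x. indicator (box c d) x * w x)"
    using w0 by (auto simp: fun_eq_iff sub indicator_def)
  ultimately show "(\<integral>x. indicator (box c d) x * w x \<partial>lborel) = 0"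
    by (simp add: LIMSEQ_const_iff)
qed

subsection \<open>Mollification\<close>

lemma smooth_on_translate:
  assumes "smooth_on UNIV K"
  shows "smooth_on UNIV (\<lambda>y. K (y - x))"
    and "frechet_derivative (\<lambda>y. K (y - x)) (at y) = frechet_derivative K (at (y - x))"
proof -
  have D: "((\<lambda>y. K (y - x)) has_derivative frechet_derivative K (at (y - x))) (at y)"
    if "smooth_on UNIV K" for K :: "real^'b \<Rightarrow> real" and x y
  proof -
    have "((\<lambda>y. y - x) has_derivative (\<lambda>h. h)) (at y)" by (auto intro!: derivative_eq_intros)
    from has_derivative_compose[OF this smooth_on_has_derivative[OF that open_UNIV]] show ?thesis by simp
  qed
  show "frechet_derivative (\<lambda>y. K (y - x)) (at y) = frechet_derivative K (at (y - x))"
    by (rule frechet_derivative_at[OF D[OF assms], symmetric])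
  have "Cm_on m UNIV (\<lambda>y. K (y - x))" if "smooth_on UNIV K" for m and K :: "real^'a \<Rightarrow> real"
    using that
  proof (induction m arbitrary: K)
    case 0
    have "continuous_on UNIV K" by (rule smooth_on_imp_continuous_on[OF 0])
    then have "continuous_on UNIV (\<lambda>y. K (y - x))"
      by (rule continuous_on_compose2) (auto intro!: continuous_intros)
    then show ?case by simp
  next
    case (Suc m)
    show ?case by (rule Cm_on_SucI[OF open_UNIV D[OF Suc.prems] Suc.IH[OF smooth_on_partial[OF Suc.prems]]])
  qed
  with assms show "smooth_on UNIV (\<lambda>y. K (y - x))" by (simp add: smooth_on_def)
qed

lemma frechet_derivative_eq_sum_partial:
  fixes K :: "real^'n \<Rightarrow> real"
  assumes "K differentiable at z"
  shows "frechet_derivative K (at z) h = (\<Sum>j\<in>UNIV. h $ j * frechet_derivative K (at z) (axis j 1))"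
proof -
  have lin: "linear (frechet_derivative K (at z))"
    using assms by (rule linear_frechet_derivative)
  have "frechet_derivative K (at z) h = frechet_derivative K (at z) (\<Sum>j\<in>UNIV. h $ j *s axis j 1)"
    by (simp only: basis_expansion)
  also have "\<dots> = (\<Sum>j\<in>UNIV. h $ j * frechet_derivative K (at z) (axis j 1))"
    by (simp add: linear_sum[OF lin] linear_scale[OF lin] scalar_mult_eq_scaleR)
  finally show ?thesis .
qed

lemma partial_bounded_support:
  assumes S: "closed S" "\<And>x. x \<notin> S \<Longrightarrow> K x = 0" and "z \<notin> S"
  shows "frechet_derivative K (at z) v = (0::real)"
proof -
  have "((\<lambda>x. 0) has_derivative (\<lambda>h. 0)) (at z)" by simp
  then have "(K has_derivative (\<lambda>h. 0)) (at z)"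
    by (rule has_derivative_transform_within_open[of _ _ _ _ "- S"]) (use assms in auto)
  from frechet_derivative_at[OF this] show ?thesis by metis
qed

text \<open>Compact support makes the partial derivatives uniformly continuous, and the mean value
  inequality turns this into a Taylor remainder whose \<open>d\<close> does not depend on
  \<open>z\<close>. Such uniformity permits differentiation under the integral sign.\<close>

lemma smooth_uniform_linearization:
  fixes K :: "real^'n \<Rightarrow> real"
  assumes K: "smooth_on UNIV K" and S: "compact S" "\<And>x. x \<notin> S \<Longrightarrow> K x = 0" and "e > 0"
  shows "\<exists>d>0. \<forall>z h. norm h < d \<longrightarrow> \<bar>K (z + h) - K z - frechet_derivative K (at z) h\<bar> \<le> e * norm h"
proof -
  define Q where "Q j z = frechet_derivative K (at z) (axis j 1)" for j z
  \<comment> \<open>The difference of two differentials is estimated by a sum over the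
    \<open>CARD('n)\<close> partial derivatives, each allowed this share of
    \<open>e\<close>.\<close>
  define c where "c = e / real CARD('n)"
  have "c > 0" using \<open>e > 0\<close> by (simp add: c_def)
  have uc: "uniformly_continuous_on UNIV (Q j)" for j
    unfolding Q_def
    using smooth_on_imp_continuous_on[OF smooth_on_partial[OF K]] compact_imp_bounded[OF S(1)]
      partial_bounded_support[OF compact_imp_closed[OF S(1)] S(2)]
    by (rule uniformly_continuous_on_bounded_support)
  have "\<forall>j. \<exists>d>0. \<forall>x y. dist y x < d \<longrightarrow> dist (Q j y) (Q j x) < c"
    using uc \<open>c > 0\<close> unfolding uniformly_continuous_on_def by auto
  then obtain d where d: "\<And>j. d j > 0" "\<And>j x y. dist y x < d j \<Longrightarrow> dist (Q j y) (Q j x) < c"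
    by metis
  define \<delta> where "\<delta> = Min (range d)"
  have \<delta>: "\<delta> > 0" "\<And>j. \<delta> \<le> d j" using d(1) by (auto simp: \<delta>_def)
  have diff: "K differentiable at z" for z
    using smooth_on_has_derivative[OF K open_UNIV] by (metis UNIV_I differentiable_def)
  have "\<bar>K (z + h) - K z - frechet_derivative K (at z) h\<bar> \<le> e * norm h" if h: "norm h < \<delta>" for z h
  proof -
    have on: "onorm (frechet_derivative K (at x) - frechet_derivative K (at z)) \<le> e" if x: "x \<in> ball z \<delta>" for x
    proof (rule onorm_le)
      fix v
      have "norm ((frechet_derivative K (at x) - frechet_derivative K (at z)) v)
          = \<bar>\<Sum>j\<in>UNIV. v $ j * (Q j x - Q j z)\<bar>"
        unfolding minus_apply frechet_derivative_eq_sum_partial[OF diff, of _ v] Q_def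
        by (simp add: sum_subtractf right_diff_distrib)
      also have "\<dots> \<le> (\<Sum>j\<in>UNIV. \<bar>v $ j * (Q j x - Q j z)\<bar>)" by (rule sum_abs)
      also have "\<dots> \<le> (\<Sum>j\<in>(UNIV::'n set). norm v * c)"
      proof (rule sum_mono)
        fix j
        have "dist x z < d j" using x \<delta>(2)[of j] by (simp add: dist_commute)
        then have "\<bar>Q j x - Q j z\<bar> \<le> c" using d(2)[of x z j] by (simp add: dist_real_def)
        then show "\<bar>v $ j * (Q j x - Q j z)\<bar> \<le> norm v * c"
          unfolding abs_mult by (intro mult_mono component_le_norm_cart) auto
      qed
      also have "\<dots> = e * norm v" by (simp add: c_def)
      finally show "norm ((frechet_derivative K (at x) - frechet_derivative K (at z)) v) \<le> e * norm v" .
    qed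
    have "norm (K (z + h) - K z - frechet_derivative K (at z) ((z + h) - z)) \<le> norm ((z + h) - z) * e"
    proof (rule differentiable_bound_linearization[where S="ball z \<delta>"])
      show "z + t *\<^sub>R (z + h - z) \<in> ball z \<delta>" if "t \<in> {0..1}" for t
        using that h mult_left_le_one_le[of "norm h" "t"] by (auto simp: dist_norm)
      show "(K has_derivative frechet_derivative K (at x)) (at x within ball z \<delta>)" for x
        using smooth_on_has_derivative[OF K open_UNIV] by (simp add: has_derivative_at_withinI)
    qed (use on \<delta>(1) in \<open>auto simp: fun_diff_def\<close>)
    then show ?thesis by (simp add: mult.commute)
  qed
  with \<delta>(1) show ?thesis by blast
qed

lemma continuous_translate: "continuous_on UNIV g \<Longrightarrow> continuous_on UNIV (\<lambda>y. g (y - x))"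
  for x :: "'a::real_normed_vector"
  by (rule continuous_on_compose2) (auto intro!: continuous_intros)

lemma bounded_support_translate:
  fixes x :: "'a::real_normed_vector"
  assumes S: "bounded S" "\<And>z. z \<notin> S \<Longrightarrow> g z = 0"
  shows "bounded ((+) x ` S)" "y \<notin> (+) x ` S \<Longrightarrow> g (y - x) = 0"
proof -
  show "bounded ((+) x ` S)" by (rule bounded_translation[OF S(1)])
  show "g (y - x) = 0" if "y \<notin> (+) x ` S"
    using that by (intro S(2)) (metis add.commute diff_add_cancel image_eqI)
qed

lemma integrable_mult_translate:
  fixes u :: "'a::euclidean_space \<Rightarrow> real"
  assumes "integrable lborel u" "continuous_on UNIV g" "bounded S" "\<And>z. z \<notin> S \<Longrightarrow> g z = 0"
  shows "integrable lborel (\<lambda>y. u y * g (y - x))"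
  using assms(1) continuous_translate[OF assms(2)] bounded_support_translate[OF assms(3,4)]
  by (rule integrable_mult_continuous_bounded_support)

text \<open>Uniform linearization bounds the remainder of the integrand by
  \<open>c * norm h * \<bar>u y\<bar>\<close>, which is simply integrated. The minus sign is the
  inner derivative of \<open>y - x\<close> with respect to \<open>x\<close>.\<close>

lemma mollify_has_derivative:
  fixes u K :: "real^'n \<Rightarrow> real"
  assumes u: "integrable lborel u"
    and K: "smooth_on UNIV K" and S: "compact S" "\<And>x. x \<notin> S \<Longrightarrow> K x = 0"
  shows "((\<lambda>x. \<integral>y. u y * K (y - x) \<partial>lborel) has_derivative
     (\<lambda>h. \<Sum>j\<in>UNIV. h $ j * - (\<integral>y. u y * frechet_derivative K (at (y - x)) (axis j 1) \<partial>lborel))) (at x)"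
  unfolding has_derivative_at_alt
proof (intro conjI allI impI)
  define Q where "Q j z = frechet_derivative K (at z) (axis j 1)" for j z
  have diff: "K differentiable at z" for z
    using smooth_on_has_derivative[OF K open_UNIV] by (metis UNIV_I differentiable_def)
  have intK: "integrable lborel (\<lambda>y. u y * K (y - x))" for x
    by (rule integrable_mult_translate[OF u smooth_on_imp_continuous_on[OF K] compact_imp_bounded[OF S(1)] S(2)])
  have intQ: "integrable lborel (\<lambda>y. u y * Q j (y - x))" for j
    unfolding Q_def
    by (rule integrable_mult_translate[OF u smooth_on_imp_continuous_on[OF smooth_on_partial[OF K]]
          compact_imp_bounded[OF S(1)] partial_bounded_support[OF compact_imp_closed[OF S(1)] S(2)]])
  show "bounded_linear (\<lambda>h. \<Sum>j\<in>UNIV. h $ j * - (\<integral>y. u y * frechet_derivative K (at (y - x)) (axis j 1) \<partial>lborel))"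
    by (intro bounded_linear_sum bounded_linear_mult_left[THEN bounded_linear_compose] bounded_linear_vec_nth)
  fix e :: real assume "e > 0"
  define I where "I = (\<integral>y. \<bar>u y\<bar> \<partial>lborel)"
  have "I \<ge> 0" by (simp add: I_def)
  \<comment> \<open>The summand 1 keeps the denominator positive even if \<open>u\<close> vanishes
    almost everywhere.\<close>
  define c where "c = e / (I + 1)"
  have "c > 0" "c * I \<le> e" using \<open>e > 0\<close> \<open>I \<ge> 0\<close> by (simp_all add: c_def field_simps)
  obtain d where "d > 0" and d: "\<And>z h. norm h < d \<Longrightarrow> \<bar>K (z + h) - K z - frechet_derivative K (at z) h\<bar> \<le> c * norm h"
    using smooth_uniform_linearization[OF K S \<open>c > 0\<close>] by blast
  have "norm ((\<integral>y. u y * K (y - x') \<partial>lborel) - (\<integral>y. u y * K (y - x) \<partial>lborel)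
      - (\<Sum>j\<in>UNIV. (x' - x) $ j * - (\<integral>y. u y * Q j (y - x) \<partial>lborel))) \<le> e * norm (x' - x)"
    if x': "norm (x' - x) < d" for x'
  proof -
    define h where "h = x' - x"
    have "(\<integral>y. u y * K (y - x') \<partial>lborel) - (\<integral>y. u y * K (y - x) \<partial>lborel)
        - (\<Sum>j\<in>UNIV. h $ j * - (\<integral>y. u y * Q j (y - x) \<partial>lborel))
        = (\<integral>y. u y * K (y - x') - u y * K (y - x) - (\<Sum>j\<in>UNIV. - h $ j * (u y * Q j (y - x))) \<partial>lborel)"
      by (subst Bochner_Integration.integral_diff Bochner_Integration.integral_sum integral_mult_right_zero |
          intro Bochner_Integration.integrable_diff Bochner_Integration.integrable_sum intK intQ integrable_mult_right)+
        (simp add: sum_negf)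
    also have "\<dots> = (\<integral>y. u y * (K ((y - x) + - h) - K (y - x) - frechet_derivative K (at (y - x)) (- h)) \<partial>lborel)"
      unfolding frechet_derivative_eq_sum_partial[OF diff, of _ "- h"] Q_def[symmetric]
      by (intro Bochner_Integration.integral_cong refl)
        (simp add: h_def algebra_simps sum_distrib_left)
    finally have eq: "(\<integral>y. u y * K (y - x') \<partial>lborel) - (\<integral>y. u y * K (y - x) \<partial>lborel)
        - (\<Sum>j\<in>UNIV. h $ j * - (\<integral>y. u y * Q j (y - x) \<partial>lborel))
        = (\<integral>y. u y * (K ((y - x) + - h) - K (y - x) - frechet_derivative K (at (y - x)) (- h)) \<partial>lborel)" .
    have "norm (\<integral>y. u y * (K ((y - x) + - h) - K (y - x) - frechet_derivative K (at (y - x)) (- h)) \<partial>lborel)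
        \<le> (\<integral>y. \<bar>u y\<bar> * (c * norm h) \<partial>lborel)"
    unfolding real_norm_def
    proof (rule Bochner_Integration.integral_abs_bound_integral)
      show "integrable lborel (\<lambda>y. \<bar>u y\<bar> * (c * norm h))" using u by simp
      show "integrable lborel (\<lambda>y. u y * (K ((y - x) + - h) - K (y - x) - frechet_derivative K (at (y - x)) (- h)))"
      proof -
        have "integrable lborel (\<lambda>y. u y * K (y - x') - u y * K (y - x) - (\<Sum>j\<in>UNIV. - h $ j * (u y * Q j (y - x))))"
          by (intro Bochner_Integration.integrable_diff Bochner_Integration.integrable_sum intK intQ integrable_mult_right)
        moreover have "(\<lambda>y. u y * K (y - x') - u y * K (y - x) - (\<Sum>j\<in>UNIV. - h $ j * (u y * Q j (y - x))))
          = (\<lambda>y. u y * (K ((y - x) + - h) - K (y - x) - frechet_derivative K (at (y - x)) (- h)))"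
          unfolding frechet_derivative_eq_sum_partial[OF diff, of _ "- h"] Q_def[symmetric]
          by (simp add: h_def algebra_simps sum_distrib_left)
        ultimately show ?thesis by simp
      qed
      show "\<bar>u y * (K ((y - x) + - h) - K (y - x) - frechet_derivative K (at (y - x)) (- h))\<bar> \<le> \<bar>u y\<bar> * (c * norm h)" for y
        using d[of "- h" "y - x"] x' unfolding abs_mult h_def
        by (intro mult_left_mono) (auto simp: norm_minus_commute)
    qed
    also have "\<dots> = (c * I) * norm h" by (simp add: I_def)
    also have "\<dots> \<le> e * norm h" using \<open>c * I \<le> e\<close> by (rule mult_right_mono) simp
    finally show ?thesis using eq by (simp add: h_def)
  qed
  with \<open>d > 0\<close> show "\<exists>d>0. \<forall>x'. norm (x' - x) < d \<longrightarrow>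
      norm ((\<integral>y. u y * K (y - x') \<partial>lborel) - (\<integral>y. u y * K (y - x) \<partial>lborel)
      - (\<Sum>j\<in>UNIV. (x' - x) $ j * - (\<integral>y. u y * frechet_derivative K (at (y - x)) (axis j 1) \<partial>lborel)))
      \<le> e * norm (x' - x)"
    unfolding Q_def by blast
qed

text \<open>Evenness is included to make convolution with \<open>K\<close> self-adjoint.\<close>

definition mollifier :: "real \<Rightarrow> (real^'n \<Rightarrow> real) \<Rightarrow> bool" where
  "mollifier e K \<longleftrightarrow> smooth_on UNIV K \<and> (\<forall>z. 0 \<le> K z) \<and> (\<forall>z. e < norm z \<longrightarrow> K z = 0) \<and>
     (\<forall>z. K (- z) = K z) \<and> (\<integral>z. K z \<partial>lborel) = 1"

text \<open>A vanishing integral would make the nonnegative bump zero almost everywhere. Its zero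
  set is closed, so it would be the whole space, against positivity inside the box.\<close>

lemma box_bump_integral_pos:
  assumes "box a b \<noteq> {}"
  shows "(\<integral>z. box_bump 1 a b z \<partial>lborel) > 0"
proof (rule ccontr)
  assume "\<not> ?thesis"
  moreover have "(\<integral>z. box_bump 1 a b z \<partial>lborel) \<ge> 0" by (simp add: box_bump_nonneg)
  ultimately have 0: "(\<integral>z. box_bump 1 a b z \<partial>lborel) = 0" by linarith
  have c: "continuous_on UNIV (box_bump 1 a b)"
    by (rule smooth_on_imp_continuous_on[OF smooth_on_box_bump])
  have "integrable lborel (box_bump 1 a b)"
    by (rule integrable_continuous_bounded_support[OF c, of "box a b"]) (simp_all add: box_bump_zero)
  with 0 have "AE z in lborel. box_bump 1 a b z = 0"
    by (subst (asm) integral_nonneg_eq_0_iff_AE) (simp_all add: box_bump_nonneg)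
  then have "AE z in lebesgue. z \<in> {z. box_bump 1 a b z = 0}"
    by (simp add: AE_completion)
  moreover have "closed {z. box_bump 1 a b z = 0}"
    by (intro closed_Collect_eq c continuous_on_const)
  ultimately have "z \<in> {z. box_bump 1 a b z = 0}" for z
    using mem_closed_if_AE_lebesgue by blast
  then show False using assms box_bump_pos[of 1 _ a b] by fastforce
qed

lemma exists_mollifier:
  assumes "e > 0"
  shows "\<exists>K::real^'n \<Rightarrow> real. mollifier e K"
proof -
  \<comment> \<open>A cube centred at 0 gives an even bump. With half-side
    \<open>e / CARD('n)\<close> the sum of the coordinates' absolute values is at most
    \<open>e\<close>, and it bounds the norm.\<close>
  define a :: "real^'n" where "a = (\<chi> i. e / real CARD('n))"
  define C where "C = (\<integral>z. box_bump 1 (-a) a z \<partial>lborel)"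
  have "0 \<in> box (-a) a" using assms by (simp add: mem_box_cart a_def)
  then have "C > 0" unfolding C_def by (intro box_bump_integral_pos) auto
  define K where "K z = inverse C * box_bump 1 (-a) a z" for z
  have "smooth_on UNIV K"
    unfolding K_def by (intro smooth_on_mult smooth_on_const smooth_on_box_bump open_UNIV)
  moreover have "0 \<le> K z" for z using \<open>C > 0\<close> by (simp add: K_def box_bump_nonneg)
  moreover have "K z = 0" if "e < norm z" for z
  proof -
    have "norm z \<le> e" if z: "z \<in> box (-a) a"
    proof -
      have "norm z \<le> (\<Sum>i\<in>UNIV. \<bar>z $ i\<bar>)" by (rule norm_le_l1_cart)
      also have "\<dots> \<le> (\<Sum>i\<in>(UNIV::'n set). e / real CARD('n))"
        using z by (intro sum_mono) (simp add: mem_box_cart a_def abs_le_iff, metis less_imp_le minus_less_iff)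
      finally show ?thesis by simp
    qed
    with that have "z \<notin> box (-a) a" by force
    then show ?thesis by (simp add: K_def box_bump_zero)
  qed
  moreover have "K (- z) = K z" for z
    by (simp add: K_def box_bump_def a_def algebra_simps mult.commute)
  moreover have "(\<integral>z. K z \<partial>lborel) = 1"
    using \<open>C > 0\<close> by (simp add: K_def C_def)
  ultimately show ?thesis unfolding mollifier_def by blast
qed

lemma mollifierD:
  assumes "mollifier e K"
  shows "smooth_on UNIV K" "0 \<le> K z" "z \<notin> cball 0 e \<Longrightarrow> K z = 0" "K (- z) = K z"
    "(\<integral>y. K (y - x) \<partial>lborel) = 1" "integrable lborel (\<lambda>y. K (y - x))"
proof -
  show K: "smooth_on UNIV K" and "0 \<le> K z" and "K (- z) = K z"
    and 0: "z \<notin> cball 0 e \<Longrightarrow> K z = 0" for z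
    using assms by (simp_all add: mollifier_def)
  have cont: "continuous_on UNIV K" by (rule smooth_on_imp_continuous_on[OF K])
  have "(\<integral>y. K (y - x) \<partial>lborel) = (\<integral>y. K y \<partial>distr lborel borel ((+) (- x)))"
    using borel_measurable_continuous_onI[OF cont] by (subst integral_distr) simp_all
  then show "(\<integral>y. K (y - x) \<partial>lborel) = 1"
    using assms by (simp add: lborel_distr_plus mollifier_def)
  show "integrable lborel (\<lambda>y. K (y - x))"
    using continuous_translate[OF cont] bounded_support_translate[OF bounded_cball 0]
    by (rule integrable_continuous_bounded_support)
qed

text \<open>The integral is an average of \<open>g\<close> against a probability density living
  within distance \<open>e\<close> of \<open>x\<close>.\<close>

lemma mollify_close:
  assumes K: "mollifier e K" and int: "integrable lborel (\<lambda>y. g y * K (y - x))"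
    and close: "\<And>y. norm (y - x) \<le> e \<Longrightarrow> \<bar>g y - g x\<bar> \<le> c"
  shows "\<bar>(\<integral>y. g y * K (y - x) \<partial>lborel) - g x\<bar> \<le> c"
proof -
  note D = mollifierD[OF K]
  have int': "integrable lborel (\<lambda>y. (g y - g x) * K (y - x))"
    using int D(6)[of x] by (simp add: left_diff_distrib)
  have "(\<integral>y. g y * K (y - x) \<partial>lborel) - g x = (\<integral>y. g y * K (y - x) \<partial>lborel) - (\<integral>y. g x * K (y - x) \<partial>lborel)"
    by (simp add: D(5))
  also have "\<dots> = (\<integral>y. (g y - g x) * K (y - x) \<partial>lborel)"
    using int D(6)[of x] by (simp add: left_diff_distrib)
  also have "norm \<dots> \<le> (\<integral>y. c * K (y - x) \<partial>lborel)"
  unfolding real_norm_def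
  proof (rule Bochner_Integration.integral_abs_bound_integral[OF int'])
    show "integrable lborel (\<lambda>y. c * K (y - x))" using D(6) by simp
    show "\<bar>(g y - g x) * K (y - x)\<bar> \<le> c * K (y - x)" for y
      using close[of y] D(2)[of "y - x"] D(3)[of "y - x"]
      by (cases "norm (y - x) \<le> e") (auto simp: abs_mult intro: mult_right_mono)
  qed
  also have "\<dots> = c" by (simp add: D(5))
  finally show ?thesis by simp
qed

lemma integrable_pair_mult:
  fixes u v :: "'a::euclidean_space \<Rightarrow> real"
  assumes u: "integrable lborel u" and v: "integrable lborel v"
  shows "integrable (lborel \<Otimes>\<^sub>M lborel) (\<lambda>(x,y). v x * u y)"
proof (rule lborel_pair.Fubini_integrable)
  have [measurable]: "u \<in> borel_measurable borel" "v \<in> borel_measurable borel" using u v by auto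
  show "(\<lambda>(x,y). v x * u y) \<in> borel_measurable (lborel \<Otimes>\<^sub>M lborel)" by measurable
  show "integrable lborel (\<lambda>x. \<integral>y. norm (case (x, y) of (x, y) \<Rightarrow> v x * u y) \<partial>lborel)"
    using v by (simp add: abs_mult)
  show "AE x in lborel. integrable lborel (\<lambda>y. case (x, y) of (x, y) \<Rightarrow> v x * u y)"
    using u by simp
qed

text \<open>Fubini, with \<open>C * \<bar>\<phi> x * u y\<bar>\<close> as majorant on the product;
  evenness of \<open>K\<close> turns the kernel around, so the mollification passes from
  \<open>u\<close> to \<open>\<phi>\<close>.\<close>

lemma mollify_swap:
  fixes u \<phi> :: "real^'n \<Rightarrow> real"
  assumes u: "integrable lborel u"
    and \<phi>: "continuous_on UNIV \<phi>" "bounded S" "\<And>x. x \<notin> S \<Longrightarrow> \<phi> x = 0"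
    and K: "mollifier e K"
  shows "(\<integral>x. (\<integral>y. u y * K (y - x) \<partial>lborel) * \<phi> x \<partial>lborel) = (\<integral>y. u y * (\<integral>x. \<phi> x * K (x - y) \<partial>lborel) \<partial>lborel)"
proof -
  note D = mollifierD[OF K]
  have contK: "continuous_on UNIV K" by (rule smooth_on_imp_continuous_on[OF D(1)])
  obtain C where C: "\<And>z. \<bar>K z\<bar> \<le> C"
    using bounded_of_bounded_support[OF contK bounded_cball D(3)] by blast
  have int\<phi>: "integrable lborel \<phi>" by (rule integrable_continuous_bounded_support[OF \<phi>])
  have [measurable]: "u \<in> borel_measurable borel" "\<phi> \<in> borel_measurable borel" "K \<in> borel_measurable borel"
    using u int\<phi> borel_measurable_continuous_onI[OF contK] by auto
  have "integrable (lborel \<Otimes>\<^sub>M lborel) (\<lambda>(x,y). (u y * K (y - x)) * \<phi> x)"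
  proof (rule Bochner_Integration.integrable_bound)
    show "integrable (lborel \<Otimes>\<^sub>M lborel) (\<lambda>z. C * (case z of (x,y) \<Rightarrow> \<phi> x * u y))"
      by (intro integrable_mult_right integrable_pair_mult u int\<phi>)
    show "AE z in lborel \<Otimes>\<^sub>M lborel. norm (case z of (x,y) \<Rightarrow> (u y * K (y - x)) * \<phi> x)
        \<le> norm (C * (case z of (x,y) \<Rightarrow> \<phi> x * u y))"
    proof (rule AE_I2)
      fix z :: "(real^'n) \<times> (real^'n)"
      obtain x y where z: "z = (x,y)" by force
      have "\<bar>K (y - x)\<bar> * \<bar>\<phi> x * u y\<bar> \<le> \<bar>C\<bar> * \<bar>\<phi> x * u y\<bar>"
        using C[of "y - x"] by (intro mult_right_mono) auto
      then show "norm (case z of (x,y) \<Rightarrow> (u y * K (y - x)) * \<phi> x) \<le> norm (C * (case z of (x,y) \<Rightarrow> \<phi> x * u y))"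
        by (simp add: z abs_mult mult_ac)
    qed
  qed measurable
  from lborel_pair.Fubini_integral[OF this]
  have "(\<integral>x. (\<integral>y. (u y * K (y - x)) * \<phi> x \<partial>lborel) \<partial>lborel) = (\<integral>y. (\<integral>x. (u y * K (y - x)) * \<phi> x \<partial>lborel) \<partial>lborel)"
    by simp
  moreover have "(\<integral>x. (u y * K (y - x)) * \<phi> x \<partial>lborel) = u y * (\<integral>x. \<phi> x * K (x - y) \<partial>lborel)" for y
  proof -
    have "K (y - x) = K (x - y)" for x using D(4)[of "x - y"] by simp
    then show ?thesis by (simp add: mult_ac flip: integral_mult_right_zero)
  qed
  ultimately show ?thesis by simp
qed

text \<open>After the swap it is the uniformly continuous \<open>\<phi>\<close> that is mollified,
  with error at most \<open>c\<close> everywhere, and integrability of \<open>u\<close>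
  suffices.\<close>

lemma mollify_tendsto_weak:
  fixes u \<phi> :: "real^'n \<Rightarrow> real"
  assumes u: "integrable lborel u"
    and \<phi>: "continuous_on UNIV \<phi>" "bounded S" "\<And>x. x \<notin> S \<Longrightarrow> \<phi> x = 0"
    and K: "\<And>n. mollifier (e n) (K n)" and e: "e \<longlonglongrightarrow> 0"
  shows "(\<lambda>n. \<integral>x. (\<integral>y. u y * K n (y - x) \<partial>lborel) * \<phi> x \<partial>lborel) \<longlonglongrightarrow> (\<integral>x. u x * \<phi> x \<partial>lborel)"
proof (rule LIMSEQ_I)
  fix r :: real assume "r > 0"
  define I where "I = (\<integral>y. \<bar>u y\<bar> \<partial>lborel)"
  have "I \<ge> 0" by (simp add: I_def)
  \<comment> \<open>Chosen for \<open>I * c < r\<close>; the summand 1 covers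
    \<open>I = 0\<close>.\<close>
  define c where "c = r / (2 * (I + 1))"
  have "c > 0" using \<open>r > 0\<close> \<open>I \<ge> 0\<close> by (simp add: c_def)
  have "I * r < r * (2 * (I + 1))"
    using \<open>r > 0\<close> \<open>I \<ge> 0\<close> mult_strict_left_mono[of I "2 * (I + 1)" r] by (simp add: mult.commute)
  then have cI: "I * c < r" using \<open>I \<ge> 0\<close> by (simp add: c_def divide_less_eq)
  obtain d where "d > 0" and d: "\<And>x y. dist y x < d \<Longrightarrow> \<bar>\<phi> y - \<phi> x\<bar> < c"
    using uniformly_continuous_on_bounded_support[OF \<phi>] \<open>c > 0\<close>
    unfolding uniformly_continuous_on_def dist_real_def by (metis UNIV_I)
  obtain N where N: "\<And>n. n \<ge> N \<Longrightarrow> e n < d"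
    using order_tendstoD(2)[OF e \<open>d > 0\<close>] unfolding eventually_sequentially by blast
  have int\<phi>: "integrable lborel \<phi>" by (rule integrable_continuous_bounded_support[OF \<phi>])
  have "norm ((\<integral>x. (\<integral>y. u y * K n (y - x) \<partial>lborel) * \<phi> x \<partial>lborel) - (\<integral>x. u x * \<phi> x \<partial>lborel)) < r"
    if n: "n \<ge> N" for n
  proof -
    define \<psi> where "\<psi> y = (\<integral>x. \<phi> x * K n (x - y) \<partial>lborel)" for y
    note D = mollifierD[OF K[of n]]
    have contK: "continuous_on UNIV (K n)" by (rule smooth_on_imp_continuous_on[OF D(1)])
    have close: "\<bar>\<psi> y - \<phi> y\<bar> \<le> c" for y
      unfolding \<psi>_def
    proof (rule mollify_close[OF K])
      show "integrable lborel (\<lambda>x. \<phi> x * K n (x - y))"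
        by (rule integrable_mult_translate[OF int\<phi> contK bounded_cball D(3)])
      show "\<bar>\<phi> z - \<phi> y\<bar> \<le> c" if "norm (z - y) \<le> e n" for z
        using d[of z y] N[OF n] that by (simp add: dist_norm)
    qed
    have [measurable]: "\<phi> \<in> borel_measurable borel" "K n \<in> borel_measurable borel"
      using int\<phi> borel_measurable_continuous_onI[OF contK] by auto
    have m\<psi>: "\<psi> \<in> borel_measurable borel"
      unfolding \<psi>_def by measurable
    have int2: "integrable lborel (\<lambda>y. u y * (\<psi> y - \<phi> y))"
      by (rule integrable_mult_bounded[OF u _ close]) (use m\<psi> in measurable)
    have int1: "integrable lborel (\<lambda>y. u y * \<phi> y)"
      by (rule integrable_mult_continuous_bounded_support[OF u \<phi>])
    have "(\<integral>x. (\<integral>y. u y * K n (y - x) \<partial>lborel) * \<phi> x \<partial>lborel) = (\<integral>y. u y * \<psi> y \<partial>lborel)"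
      unfolding \<psi>_def by (rule mollify_swap[OF u \<phi> K])
    also have "\<dots> = (\<integral>y. u y * (\<psi> y - \<phi> y) + u y * \<phi> y \<partial>lborel)"
      by (simp add: right_diff_distrib)
    also have "\<dots> = (\<integral>y. u y * (\<psi> y - \<phi> y) \<partial>lborel) + (\<integral>y. u y * \<phi> y \<partial>lborel)"
      by (rule Bochner_Integration.integral_add[OF int2 int1])
    finally have "norm ((\<integral>x. (\<integral>y. u y * K n (y - x) \<partial>lborel) * \<phi> x \<partial>lborel) - (\<integral>x. u x * \<phi> x \<partial>lborel))
        = \<bar>\<integral>y. u y * (\<psi> y - \<phi> y) \<partial>lborel\<bar>" by simp
    also have "\<dots> \<le> (\<integral>y. \<bar>u y\<bar> * c \<partial>lborel)"
      using close by (intro Bochner_Integration.integral_abs_bound_integral int2)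
        (use u in \<open>auto simp: abs_mult intro: mult_left_mono\<close>)
    also have "\<dots> = I * c" by (simp add: I_def)
    finally show ?thesis using cI by linarith
  qed
  then show "\<exists>N. \<forall>n\<ge>N. norm ((\<integral>x. (\<integral>y. u y * K n (y - x) \<partial>lborel) * \<phi> x \<partial>lborel) - (\<integral>x. u x * \<phi> x \<partial>lborel)) < r"
    by blast
qed

lemma box_vec_nonempty:
  fixes x0 :: "real^'n"
  assumes "R > 0"
  shows "box (x0 - (\<chi> i. R)) (x0 + (\<chi> i. R)) \<noteq> {}"
proof -
  have "x0 \<in> box (x0 - (\<chi> i. R)) (x0 + (\<chi> i. R))" using assms by (simp add: mem_box_cart)
  then show ?thesis by blast
qed

text \<open>The mollifications of \<open>u\<close> have gradients converging uniformly to \<open>B\<close>, so after subtracting their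
  values at the centre they converge to some \<open>h\<close> with gradient \<open>B\<close>. Testing against a fixed bump
  shows that the subtracted values converge as well.\<close>
lemma weak_gradient_continuous_imp_C1:
  fixes u :: "real^'n \<Rightarrow> real" and B :: "'n \<Rightarrow> real^'n \<Rightarrow> real" and x0 :: "real^'n"
  defines "Q r \<equiv> cbox (x0 - (\<chi> i. r)) (x0 + (\<chi> i. r))"
  assumes R: "R > 0" and u: "integrable lborel u" and B: "\<And>j. continuous_on (Q (2 * R)) (B j)"
    and weak: "\<And>\<phi> j. smooth_on UNIV \<phi> \<Longrightarrow> (\<And>x. x \<notin> Q (2 * R) \<Longrightarrow> \<phi> x = 0) \<Longrightarrow>
      (\<integral>x. u x * frechet_derivative \<phi> (at x) (axis j 1) \<partial>lborel)
        = - (\<integral>x. indicator (Q (2 * R)) x * B j x * \<phi> x \<partial>lborel)"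
  shows "\<exists>h. (\<forall>x\<in>box (x0 - (\<chi> i. R)) (x0 + (\<chi> i. R)). (h has_derivative (\<lambda>v. \<Sum>j\<in>UNIV. v $ j * B j x)) (at x)) \<and>
     (AE x in lborel. x \<in> box (x0 - (\<chi> i. R)) (x0 + (\<chi> i. R)) \<longrightarrow> u x = h x)"
proof -
  define V where "V = box (x0 - (\<chi> i. R)) (x0 + (\<chi> i. R))"
  have VQ: "V \<subseteq> Q R" unfolding V_def Q_def by (rule box_subset_cbox)
  have bdV: "bounded V" by (simp add: V_def)
  \<comment> \<open>At most \<open>R\<close>, so that a kernel centred in \<open>Q R\<close> is
    supported in \<open>Q (2 * R)\<close>, where the weak equation applies.\<close>
  define e where "e n = R / real (Suc n)" for n
  have e: "e n > 0" "e n \<le> R" for n using R by (auto simp: e_def field_simps)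
  have e0: "e \<longlonglongrightarrow> 0"
    using tendsto_mult[OF tendsto_const[of R] LIMSEQ_inverse_real_of_nat]
    by (simp add: e_def[abs_def] divide_inverse)
  obtain K :: "nat \<Rightarrow> real^'n \<Rightarrow> real" where K: "\<And>n. mollifier (e n) (K n)"
    using exists_mollifier[OF e(1)] by metis
  note D = mollifierD[OF K]
  have contK: "continuous_on UNIV (K n)" for n by (rule smooth_on_imp_continuous_on[OF D(1)])
  define \<beta> where "\<beta> j x = indicator (Q (2 * R)) x * B j x" for j x
  define U where "U n x = (\<integral>y. u y * K n (y - x) \<partial>lborel)" for n x
  define G where "G n j x = (\<integral>y. \<beta> j y * K n (y - x) \<partial>lborel)" for n j x
  have near: "y \<in> Q (2 * R)" if "x \<in> Q R" "norm (y - x) \<le> R" for x y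
  proof -
    have "\<bar>y $ i - x $ i\<bar> \<le> R" for i
      using component_le_norm_cart[of "y - x" i] that(2) by simp
    with that(1) show ?thesis
      unfolding Q_def mem_box_cart by (auto simp: abs_le_iff) (smt (verit))+
  qed
  have int\<beta>: "integrable lborel (\<beta> j)" for j
  proof -
    have "bounded (B j ` Q (2 * R))"
      using B unfolding Q_def by (intro compact_imp_bounded compact_continuous_image compact_cbox)
    then obtain C where C: "\<And>x. x \<in> Q (2 * R) \<Longrightarrow> \<bar>B j x\<bar> \<le> C" unfolding bounded_iff by auto
    show ?thesis
    proof (rule integrable_bounded_support[of _ "max C 0" "Q (2 * R)"])
      have "(\<lambda>x. indicator (Q (2 * R)) x *\<^sub>R B j x) \<in> borel_measurable borel"
        by (rule borel_measurable_continuous_on_indicator[OF _ B]) (simp add: Q_def)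
      then show "\<beta> j \<in> borel_measurable borel" by (simp add: \<beta>_def[abs_def])
      show "\<bar>\<beta> j x\<bar> \<le> max C 0" for x using C[of x] by (auto simp: \<beta>_def indicator_def)
    qed (auto simp: \<beta>_def Q_def)
  qed
  \<comment> \<open>The derivative falls on \<open>K n (y - x)\<close>, which as a function of
    \<open>y\<close> is a test function supported in \<open>Q (2 * R)\<close>. The sign from the
    kernel cancels the sign in the weak equation, leaving the mollification of
    \<open>\<beta> j\<close>.\<close>
  have U': "(U n has_derivative (\<lambda>v. \<Sum>j\<in>UNIV. v $ j * G n j x)) (at x)" if x: "x \<in> Q R" for n x
  proof -
    have "- (\<integral>y. u y * frechet_derivative (K n) (at (y - x)) (axis j 1) \<partial>lborel) = G n j x" for j
    proof -
      have 0: "K n (y - x) = 0" if "y \<notin> Q (2 * R)" for y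
        using near[OF x, of y] that e(2)[of n] D(3)[of "y - x" n] by force
      have "(\<integral>y. u y * frechet_derivative (\<lambda>y. K n (y - x)) (at y) (axis j 1) \<partial>lborel) = - G n j x"
        unfolding G_def \<beta>_def by (rule weak[OF smooth_on_translate(1)[OF D(1)] 0])
      then show ?thesis by (simp add: smooth_on_translate(2)[OF D(1)])
    qed
    moreover have "(U n has_derivative (\<lambda>h. \<Sum>j\<in>UNIV. h $ j * - (\<integral>y. u y * frechet_derivative (K n) (at (y - x)) (axis j 1) \<partial>lborel))) (at x)"
      unfolding U_def[abs_def] by (rule mollify_has_derivative[OF u D(1) compact_cball D(3)])
    ultimately show ?thesis by simp
  qed
  have uniform: "\<forall>\<^sub>F n in sequentially. \<forall>x\<in>Q R. \<bar>G n j x - B j x\<bar> \<le> c" if "c > 0" for c j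
  proof -
    have "uniformly_continuous_on (Q (2 * R)) (B j)"
      using B unfolding Q_def by (intro compact_uniformly_continuous compact_cbox)
    then obtain d where "d > 0" and d: "\<And>x y. x \<in> Q (2 * R) \<Longrightarrow> y \<in> Q (2 * R) \<Longrightarrow> dist y x < d \<Longrightarrow> \<bar>B j y - B j x\<bar> < c"
      using \<open>c > 0\<close> unfolding uniformly_continuous_on_def dist_real_def by metis
    have "\<forall>\<^sub>F n in sequentially. e n < d" by (rule order_tendstoD(2)[OF e0 \<open>d > 0\<close>])
    then show ?thesis
    proof eventually_elim
      case (elim n)
      show ?case
      proof
        fix x assume x: "x \<in> Q R"
        have x2: "x \<in> Q (2 * R)" using near[OF x, of x] R by simp
        have "\<bar>(\<integral>y. \<beta> j y * K n (y - x) \<partial>lborel) - \<beta> j x\<bar> \<le> c"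
        proof (rule mollify_close[OF K])
          show "integrable lborel (\<lambda>y. \<beta> j y * K n (y - x))"
            by (rule integrable_mult_translate[OF int\<beta> contK bounded_cball D(3)])
          fix y assume y: "norm (y - x) \<le> e n"
          then have "y \<in> Q (2 * R)" using near[OF x] e(2)[of n] by simp
          with d[OF x2 this] y elim x2 show "\<bar>\<beta> j y - \<beta> j x\<bar> \<le> c" by (simp add: \<beta>_def dist_norm)
        qed
        then show "\<bar>G n j x - B j x\<bar> \<le> c" using x2 by (simp add: G_def \<beta>_def)
      qed
    qed
  qed
  define v where "v n x = U n x - U n x0" for n x
  define v' where "v' n x w = (\<Sum>j\<in>UNIV. w $ j * G n j x)" for n x w
  define h' where "h' x w = (\<Sum>j\<in>UNIV. w $ j * B j x)" for x w
  have convQ: "convex (Q R)" by (simp add: Q_def)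
  have x0Q: "x0 \<in> Q R" using R by (simp add: Q_def mem_box_cart)
  have v': "(v n has_derivative v' n x) (at x within Q R)" if "x \<in> Q R" for n x
  proof -
    have "(v n has_derivative (\<lambda>w. v' n x w - 0)) (at x)"
      unfolding v_def[abs_def] v'_def by (rule has_derivative_diff[OF U'[OF that] has_derivative_const])
    then show ?thesis by (simp add: has_derivative_at_withinI)
  qed
  have nle: "\<forall>\<^sub>F n in sequentially. \<forall>x\<in>Q R. \<forall>w. norm (v' n x w - h' x w) \<le> c * norm w" if "c > 0" for c
  proof -
    have c': "c / real CARD('n) > 0" using that by simp
    have "\<forall>\<^sub>F n in sequentially. \<forall>j\<in>UNIV. \<forall>x\<in>Q R. \<bar>G n j x - B j x\<bar> \<le> c / real CARD('n)"
      by (intro eventually_ball_finite ballI uniform[OF c']) simp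
    then show ?thesis
    proof eventually_elim
      case (elim n)
      show ?case
      proof (intro ballI allI)
        fix x w assume x: "x \<in> Q R"
        have "norm (v' n x w - h' x w) = \<bar>\<Sum>j\<in>UNIV. w $ j * (G n j x - B j x)\<bar>"
          by (simp add: v'_def h'_def sum_subtractf right_diff_distrib)
        also have "\<dots> \<le> (\<Sum>j\<in>UNIV. \<bar>w $ j * (G n j x - B j x)\<bar>)" by (rule sum_abs)
        also have "\<dots> \<le> (\<Sum>j\<in>(UNIV::'n set). norm w * (c / real CARD('n)))"
          using elim x unfolding abs_mult by (intro sum_mono mult_mono component_le_norm_cart) auto
        finally show "norm (v' n x w - h' x w) \<le> c * norm w" by (simp add: mult.commute)
      qed
    qed
  qed
  obtain h where h: "\<And>x. x \<in> Q R \<Longrightarrow> (\<lambda>n. v n x) \<longlonglongrightarrow> h x"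
    "\<And>x. x \<in> Q R \<Longrightarrow> (h has_derivative h' x) (at x within Q R)"
    \<comment> \<open>By the subtraction in \<open>v\<close> the sequence at \<open>x0\<close> is
      constantly 0; together with uniform convergence of the derivatives this gives the limit
      \<open>h\<close>.\<close>
    using has_derivative_sequence[OF convQ v' nle x0Q, of 0] by (auto simp: v_def)
  \<comment> \<open>From \<open>N\<close> on, differences of the \<open>v n\<close> are Lipschitz
    with constant 1. As all of them vanish at \<open>x0\<close>, this bounds the tail uniformly on
    \<open>Q R\<close>, which is the majorant needed for dominated convergence.\<close>
  have "\<exists>N. \<forall>m\<ge>N. \<forall>n\<ge>N. \<forall>x\<in>Q R. \<forall>y\<in>Q R. norm ((v m x - v n x) - (v m y - v n y)) \<le> 1 * norm (x - y)"
    by (rule has_derivative_sequence_Lipschitz[OF convQ v' nle]) simp_all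
  then obtain N where N: "\<And>m n x y. m \<ge> N \<Longrightarrow> n \<ge> N \<Longrightarrow> x \<in> Q R \<Longrightarrow> y \<in> Q R \<Longrightarrow>
      norm ((v m x - v n x) - (v m y - v n y)) \<le> 1 * norm (x - y)" by blast
  have cont_v: "continuous_on (Q R) (v n)" for n
    using v' by (blast intro: has_derivative_continuous_on)
  have "bounded (v N ` Q R)"
    using cont_v unfolding Q_def by (intro compact_imp_bounded compact_continuous_image compact_cbox)
  then obtain C1 where C1: "\<And>x. x \<in> Q R \<Longrightarrow> \<bar>v N x\<bar> \<le> C1" unfolding bounded_iff by auto
  have "bounded (Q R)" by (simp add: Q_def)
  then obtain C2 where C2: "\<And>x. x \<in> Q R \<Longrightarrow> norm x \<le> C2" unfolding bounded_iff by auto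
  define C where "C = C1 + 2 * C2"
  have vC: "\<bar>v (n + N) x\<bar> \<le> C" if x: "x \<in> Q R" for n x
  proof -
    have "\<bar>v (n + N) x - v N x\<bar> \<le> norm (x - x0)"
      using N[of "n + N" N x x0] x x0Q by (simp add: v_def)
    moreover have "norm (x - x0) \<le> C2 + C2"
      using C2[OF x] C2[OF x0Q] norm_triangle_ineq4[of x x0] by linarith
    ultimately show ?thesis using C1[OF x] by (simp add: C_def)
  qed
  define hV where "hV x = indicator V x * h x" for x
  have cont_h: "continuous_on (Q R) h"
    using h(2) by (blast intro: has_derivative_continuous_on)
  have "bounded (h ` Q R)"
    using cont_h unfolding Q_def by (intro compact_imp_bounded compact_continuous_image compact_cbox)
  then obtain C3 where C3: "\<And>x. x \<in> Q R \<Longrightarrow> \<bar>h x\<bar> \<le> C3" unfolding bounded_iff by auto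
  have mV: "V \<in> sets borel" by (simp add: V_def)
  have meas_hV: "hV \<in> borel_measurable borel"
  proof -
    have "(\<lambda>x. indicator V x *\<^sub>R h x) \<in> borel_measurable borel"
      by (rule borel_measurable_continuous_on_indicator[OF mV continuous_on_subset[OF cont_h VQ]])
    then show ?thesis by (simp add: hV_def[abs_def])
  qed
  have int_hV: "integrable lborel hV"
  proof (rule integrable_bounded_support[OF meas_hV _ bdV])
    show "\<bar>hV x\<bar> \<le> max C3 0" for x using C3[of x] VQ by (auto simp: hV_def indicator_def)
  qed (simp add: hV_def)
  have cont_U: "continuous_on UNIV (U n)" for n
  proof -
    have "(U n has_derivative (\<lambda>h. \<Sum>j\<in>UNIV. h $ j * - (\<integral>y. u y * frechet_derivative (K n) (at (y - x)) (axis j 1) \<partial>lborel))) (at x)" for x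
      unfolding U_def[abs_def] by (rule mollify_has_derivative[OF u D(1) compact_cball D(3)])
    then show ?thesis
      by (meson continuous_at_imp_continuous_on has_derivative_continuous)
  qed
  have lim_v: "(\<lambda>n. \<integral>x. v (n + N) x * \<phi> x \<partial>lborel) \<longlonglongrightarrow> (\<integral>x. hV x * \<phi> x \<partial>lborel)"
    if \<phi>: "continuous_on UNIV \<phi>" "\<And>x. x \<notin> V \<Longrightarrow> \<phi> x = 0" for \<phi>
  proof (rule integral_dominated_convergence[where w="\<lambda>x. \<bar>C * \<phi> x\<bar>"])
    have int\<phi>: "integrable lborel \<phi>" by (rule integrable_continuous_bounded_support[OF \<phi>(1) bdV \<phi>(2)])
    show "(\<lambda>x. hV x * \<phi> x) \<in> borel_measurable lborel"
      using meas_hV int\<phi> by (intro borel_measurable_times) auto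
    show "(\<lambda>x. v (n + N) x * \<phi> x) \<in> borel_measurable lborel" for n
      unfolding v_def using borel_measurable_continuous_onI[OF cont_U] int\<phi>
      by (intro borel_measurable_times borel_measurable_diff) auto
    show "integrable lborel (\<lambda>x. \<bar>C * \<phi> x\<bar>)" using int\<phi> by simp
    show "AE x in lborel. (\<lambda>n. v (n + N) x * \<phi> x) \<longlonglongrightarrow> hV x * \<phi> x"
    proof (rule AE_I2)
      fix x
      show "(\<lambda>n. v (n + N) x * \<phi> x) \<longlonglongrightarrow> hV x * \<phi> x"
      proof (cases "x \<in> V")
        case True
        then have "(\<lambda>n. v n x) \<longlonglongrightarrow> hV x" using h(1) VQ by (auto simp: hV_def)
        then show ?thesis by (intro tendsto_mult tendsto_const LIMSEQ_ignore_initial_segment)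
      qed (simp add: \<phi>(2))
    qed
    show "AE x in lborel. norm (v (n + N) x * \<phi> x) \<le> \<bar>C * \<phi> x\<bar>" for n
    proof (rule AE_I2)
      fix x
      show "norm (v (n + N) x * \<phi> x) \<le> \<bar>C * \<phi> x\<bar>"
      proof (cases "x \<in> V")
        case True
        then have "\<bar>v (n + N) x\<bar> \<le> \<bar>C\<bar>" using vC[of x n] VQ by auto
        then show ?thesis by (simp add: abs_mult mult_right_mono)
      qed (simp add: \<phi>(2))
    qed
  qed
  \<comment> \<open>The left side is the difference of the integrals of \<open>U (n + N)\<close> and
    \<open>v (n + N)\<close> against \<open>\<phi>\<close>: the first converges by weak convergence
    of mollifications, the second by \<open>lim_v\<close>.\<close>
  have lim_c: "(\<lambda>n. U (n + N) x0 * (\<integral>x. \<phi> x \<partial>lborel)) \<longlonglongrightarrow> (\<integral>x. u x * \<phi> x \<partial>lborel) - (\<integral>x. hV x * \<phi> x \<partial>lborel)"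
    if \<phi>: "continuous_on UNIV \<phi>" "\<And>x. x \<notin> V \<Longrightarrow> \<phi> x = 0" for \<phi>
  proof -
    have int\<phi>: "integrable lborel \<phi>" by (rule integrable_continuous_bounded_support[OF \<phi>(1) bdV \<phi>(2)])
    have intU: "integrable lborel (\<lambda>x. U n x * \<phi> x)" for n
      by (rule integrable_continuous_bounded_support[OF _ bdV])
        (use \<phi> cont_U in \<open>auto intro: continuous_on_mult\<close>)
    have "(\<integral>x. v n x * \<phi> x \<partial>lborel) = (\<integral>x. U n x * \<phi> x \<partial>lborel) - U n x0 * (\<integral>x. \<phi> x \<partial>lborel)" for n
      using intU int\<phi> by (simp add: v_def left_diff_distrib)
    then have eq: "U n x0 * (\<integral>x. \<phi> x \<partial>lborel) = (\<integral>x. U n x * \<phi> x \<partial>lborel) - (\<integral>x. v n x * \<phi> x \<partial>lborel)" for n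
      by simp
    have "(\<lambda>n. \<integral>x. U n x * \<phi> x \<partial>lborel) \<longlonglongrightarrow> (\<integral>x. u x * \<phi> x \<partial>lborel)"
      unfolding U_def by (rule mollify_tendsto_weak[OF u \<phi>(1) bdV \<phi>(2) K e0])
    then have "(\<lambda>n. \<integral>x. U (n + N) x * \<phi> x \<partial>lborel) \<longlonglongrightarrow> (\<integral>x. u x * \<phi> x \<partial>lborel)"
      by (rule LIMSEQ_ignore_initial_segment)
    then show ?thesis unfolding eq by (intro tendsto_diff lim_v \<phi>)
  qed
  obtain c where c: "(\<lambda>n. U (n + N) x0) \<longlonglongrightarrow> c"
  proof -
    define \<phi> where "\<phi> = box_bump 1 (x0 - (\<chi> i. R)) (x0 + (\<chi> i. R))"
    have "(\<integral>x. \<phi> x \<partial>lborel) > 0" unfolding \<phi>_def by (rule box_bump_integral_pos[OF box_vec_nonempty[OF R]])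
    moreover have "continuous_on UNIV \<phi>"
      unfolding \<phi>_def by (rule smooth_on_imp_continuous_on[OF smooth_on_box_bump])
    moreover have "\<phi> x = 0" if "x \<notin> V" for x
      using that by (simp add: \<phi>_def V_def box_bump_zero)
    ultimately show ?thesis
      using tendsto_divide[OF lim_c[of \<phi>] tendsto_const[of "\<integral>x. \<phi> x \<partial>lborel"]] that by simp
  qed
  \<comment> \<open>The defect \<open>u - h - c\<close> on \<open>V\<close>, extended by 0; it is
    orthogonal to all test functions on the box.\<close>
  define w where "w x = indicator V x * u x - hV x - c * indicator V x" for x
  have intV: "integrable lborel (indicator V :: _ \<Rightarrow> real)"
    by (rule integrable_bounded_support[of _ 1 V]) (use borel_measurable_indicator[OF mV] in \<open>auto simp: bdV\<close>)
  have intuV: "integrable lborel (\<lambda>x. indicator V x * u x)"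
    using integrable_mult_indicator[OF _ u, of V] mV by simp
  have intw: "integrable lborel w"
    unfolding w_def[abs_def] by (intro Bochner_Integration.integrable_diff integrable_mult_right intV intuV int_hV)
  have "AE x in lborel. w x = 0"
  proof (rule fundamental_lemma_box[OF intw])
    show "w x = 0" if "x \<notin> box (x0 - (\<chi> i. R)) (x0 + (\<chi> i. R))" for x
      using that by (simp add: w_def hV_def V_def)
    fix \<phi> :: "real^'n \<Rightarrow> real"
    assume sm: "smooth_on UNIV \<phi>" and "\<And>x. x \<notin> box (x0 - (\<chi> i. R)) (x0 + (\<chi> i. R)) \<Longrightarrow> \<phi> x = 0"
    then have \<phi>: "continuous_on UNIV \<phi>" "\<And>x. x \<notin> V \<Longrightarrow> \<phi> x = 0"
      using smooth_on_imp_continuous_on[OF sm] by (auto simp: V_def)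
    have int\<phi>: "integrable lborel \<phi>" by (rule integrable_continuous_bounded_support[OF \<phi>(1) bdV \<phi>(2)])
    have "(\<lambda>n. U (n + N) x0 * (\<integral>x. \<phi> x \<partial>lborel)) \<longlonglongrightarrow> c * (\<integral>x. \<phi> x \<partial>lborel)"
      by (intro tendsto_mult c tendsto_const)
    from LIMSEQ_unique[OF this lim_c[OF \<phi>]]
    have eq: "c * (\<integral>x. \<phi> x \<partial>lborel) = (\<integral>x. u x * \<phi> x \<partial>lborel) - (\<integral>x. hV x * \<phi> x \<partial>lborel)" by simp
    have "(\<integral>x. w x * \<phi> x \<partial>lborel) = (\<integral>x. u x * \<phi> x - hV x * \<phi> x - c * \<phi> x \<partial>lborel)"
      by (rule Bochner_Integration.integral_cong) (use \<phi>(2) in \<open>auto simp: w_def indicator_def algebra_simps\<close>)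
    also have "\<dots> = (\<integral>x. u x * \<phi> x \<partial>lborel) - (\<integral>x. hV x * \<phi> x \<partial>lborel) - c * (\<integral>x. \<phi> x \<partial>lborel)"
      using integrable_mult_continuous_bounded_support[OF u \<phi>(1) bdV \<phi>(2)]
        integrable_mult_continuous_bounded_support[OF int_hV \<phi>(1) bdV \<phi>(2)] int\<phi> by simp
    finally show "(\<integral>x. w x * \<phi> x \<partial>lborel) = 0" using eq by simp
  qed
  then have ae: "AE x in lborel. x \<in> V \<longrightarrow> u x = h x + c"
    by eventually_elim (auto simp: w_def hV_def)
  have "((\<lambda>x. h x + c) has_derivative (\<lambda>v. \<Sum>j\<in>UNIV. v $ j * B j x)) (at x)" if x: "x \<in> V" for x
  proof -
    \<comment> \<open>The derivative of \<open>h\<close> was obtained relative to the closed cube;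
      at interior points it is the full derivative.\<close>
    have "at x within Q R = at x"
    proof (rule at_within_interior)
      show "x \<in> interior (Q R)" using x unfolding V_def Q_def by (simp add: interior_cbox)
    qed
    then have "(h has_derivative h' x) (at x)" using h(2)[of x] x VQ by auto
    from has_derivative_add[OF this has_derivative_const[of c]] show ?thesis by (simp add: h'_def)
  qed
  with ae show ?thesis unfolding V_def by blast
qed

section \<open>Local smoothness of the differential\<close>

lemma smooth_on_det_mat:
  assumes U: "open U" and h: "\<And>i j. i < n \<Longrightarrow> j < n \<Longrightarrow> smooth_on U (\<lambda>x. h x i j)"
  shows "smooth_on U (\<lambda>x. Determinant.det (Matrix.mat n n (\<lambda>(i,j). h x i j)) :: real)"
proof -
  have "Determinant.det (Matrix.mat n n (\<lambda>(i,j). h x i j))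
      = (\<Sum>\<pi> | \<pi> permutes {0..<n}. of_int (sign \<pi>) * (\<Prod>i = 0..<n. h x i (\<pi> i)))" for x
  proof -
    have "Matrix.mat n n (\<lambda>(i,j). h x i j) $$ (i, \<pi> i) = h x i (\<pi> i)"
      if "\<pi> permutes {0..<n}" "i \<in> {0..<n}" for \<pi> i
      using that permutes_in_image[OF that(1), of i] by simp
    then show ?thesis by (subst det_def'[of _ n]) (auto intro!: sum.cong prod.cong)
  qed
  moreover have "smooth_on U (\<lambda>x. \<Sum>\<pi> | \<pi> permutes {0..<n}. of_int (sign \<pi>) * (\<Prod>i = 0..<n. h x i (\<pi> i)))"
  proof (intro smooth_on_sum smooth_on_mult smooth_on_const smooth_on_prod U h)
    fix \<pi> i assume "\<pi> \<in> {\<pi>. \<pi> permutes {0..<n}}" "i \<in> {0..<n}"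
    then have "\<pi> permutes {0..<n}" "i \<in> {0..<n}" by auto
    from permutes_in_image[OF this(1), of i] this(2) show "i < n" "\<pi> i < n" by auto
  qed
  ultimately show ?thesis by simp
qed

lemma smooth_on_adj_mat:
  assumes U: "open U" and ij: "i < n" "j < n"
    and h: "\<And>i j. i < n \<Longrightarrow> j < n \<Longrightarrow> smooth_on U (\<lambda>x. h x i j)"
  shows "smooth_on U (\<lambda>x. adj_mat (Matrix.mat n n (\<lambda>(i,j). h x i j)) $$ (i,j) :: real)"
proof -
  have "mat_delete (Matrix.mat n n (\<lambda>(i,j). h x i j)) j i
      = Matrix.mat (n - 1) (n - 1) (\<lambda>(a,b). h x (insert_index j a) (insert_index i b))" for x
    by (rule eq_matI) (auto simp: mat_delete_def insert_index_def)
  then have "adj_mat (Matrix.mat n n (\<lambda>(i,j). h x i j)) $$ (i,j) = (-1) ^ (j + i) *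
      Determinant.det (Matrix.mat (n - 1) (n - 1) (\<lambda>(a,b). h x (insert_index j a) (insert_index i b)))" for x
    using ij by (simp add: adj_mat_def cofactor_def)
  moreover have "smooth_on U (\<lambda>x. (-1) ^ (j + i) *
      Determinant.det (Matrix.mat (n - 1) (n - 1) (\<lambda>(a,b). h x (insert_index j a) (insert_index i b))))"
    by (intro smooth_on_mult smooth_on_const smooth_on_det_mat U h) (auto simp: insert_index_def)
  ultimately show ?thesis by simp
qed

lemma smooth_on_adj_minors:
  assumes U: "open U" and G: "\<And>r c. smooth_on U (\<lambda>x. G x r c)"
  shows "smooth_on U (\<lambda>x. Determinant.det (adj_minors m (G x) r c))"
    and "i < m \<Longrightarrow> j < m \<Longrightarrow> smooth_on U (\<lambda>x. adj_minors m (G x) r c $$ (i,j))"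
    and "i < m \<Longrightarrow> j < m \<Longrightarrow> smooth_on U (\<lambda>x. adj_mat (adj_minors m (G x) r c) $$ (i,j))"
proof -
  have h: "smooth_on U (\<lambda>x. (-1)^(a+b) * G x (r \<circ> insert_index b) (c \<circ> insert_index a))" for a b
    by (intro smooth_on_mult smooth_on_const U G)
  show "smooth_on U (\<lambda>x. Determinant.det (adj_minors m (G x) r c))"
    unfolding adj_minors_def by (intro smooth_on_det_mat U h)
  show "smooth_on U (\<lambda>x. adj_minors m (G x) r c $$ (i,j))" if "i < m" "j < m"
    using h[of i j] that by (simp add: adj_minors_def)
  show "smooth_on U (\<lambda>x. adj_mat (adj_minors m (G x) r c) $$ (i,j))" if "i < m" "j < m"
    unfolding adj_minors_def by (intro smooth_on_adj_mat U h that)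
qed

lemma smooth_on_row_factor:
  assumes U: "open U" and G: "\<And>r c. smooth_on U (\<lambda>x. G x r c)" and m: "2 \<le> m" and i: "i < m"
    and nz: "\<And>x. x \<in> U \<Longrightarrow> Determinant.det (adj_minors m (G x) r c) \<noteq> 0"
  shows "smooth_on U (\<lambda>x. row_factor m (G x) r c i j)"
proof -
  have "smooth_on U (\<lambda>x. adj_mat (adj_minors m (G x) r c) $$ (i,b) *
      (let a = (if b = 0 then 1 else 0) in
       \<Sum>l<m. adj_minors m (G x) r (c(b := j)) $$ (a,l) * adj_mat (adj_minors m (G x) r c) $$ (l,a)))"
    if "b < m" for b
    unfolding Let_def using m i that
    by (intro smooth_on_mult[OF U] smooth_on_sum[OF U] smooth_on_adj_minors[OF U G]) auto
  then show ?thesis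
    unfolding row_factor_def
    by (intro smooth_on_divide[OF U] smooth_on_sum[OF U] smooth_on_power[OF U] smooth_on_adj_minors[OF U G])
      (auto simp: nz)
qed

lemma open_nonzero_smooth:
  assumes "open U" "smooth_on U g"
  shows "open {x \<in> U. g x \<noteq> 0}"
proof -
  have "open (U \<inter> g -` (- {0}))"
    using smooth_on_imp_continuous_on[OF assms(2)] assms(1) by (intro continuous_open_preimage) auto
  moreover have "U \<inter> g -` (- {0}) = {x \<in> U. g x \<noteq> 0}" by auto
  ultimately show ?thesis by simp
qed

text \<open>All the submatrices used below share the row \<open>q\<close>, which makes their determinants smooth multiples
  of one another; hence the common unknown factor \<open>\<tau>\<close>.\<close>
lemma local_smooth_factor:
  fixes G :: "real^'n \<Rightarrow> (nat \<Rightarrow> 'n) \<Rightarrow> (nat \<Rightarrow> 'n) \<Rightarrow> real" and A0 :: "real^'n^'n"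
  assumes U: "open U" and x0: "x0 \<in> U" and k: "1 \<le> k" "k < CARD('n)"
    and G: "\<And>r c. smooth_on U (\<lambda>x. G x r c)"
    and A0: "kminor k A0 = G x0" "det A0 \<noteq> 0"
  obtains W S g where "open W" "x0 \<in> W" "W \<subseteq> U" "smooth_on W g" "\<And>i j. smooth_on W (\<lambda>x. S x $ i $ j)"
    "\<And>x A. x \<in> W \<Longrightarrow> kminor k A = G x \<Longrightarrow> \<exists>\<tau>. A = \<tau> *\<^sub>R S x \<and> \<tau> ^ k = g x \<and> g x \<noteq> 0"
proof -
  define m where "m = Suc k"
  have m2: "2 \<le> m" using k by (simp add: m_def)
  fix q :: 'n
  \<comment> \<open>The set \<open>{q, i}\<close> has at most \<open>2 \<le> m\<close> elements,
    also when \<open>i = q\<close>, and \<open>m \<le> CARD('n)\<close> leaves room to enlarge it to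
    \<open>m\<close> rows.\<close>
  have "\<exists>r. inj_on r {..<m} \<and> q \<in> r ` {..<m} \<and> i \<in> r ` {..<m}" for i :: 'n
  proof -
    have "card {q, i} \<le> m" using m2 by (simp add: card_insert_if)
    moreover have "m \<le> card (UNIV :: 'n set)" using k by (simp add: m_def)
    ultimately obtain T where T: "{q, i} \<subseteq> T" "card T = m"
      using exists_subset_between[of "{q, i}" m UNIV] by auto
    then obtain r where "bij_betw r {0..<card T} T" using ex_bij_betw_nat_finite[of T] by auto
    then have "bij_betw r {..<m} T" using T(2) by (simp add: atLeast0LessThan)
    with T(1) show ?thesis unfolding bij_betw_def by blast
  qed
  then have "\<forall>i. \<exists>r. inj_on r {..<m} \<and> q \<in> r ` {..<m} \<and> i \<in> r ` {..<m}" ..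
  then obtain r :: "'n \<Rightarrow> nat \<Rightarrow> 'n" where
    r: "\<And>i. inj_on (r i) {..<m}" "\<And>i. q \<in> r i ` {..<m}" "\<And>i. i \<in> r i ` {..<m}"
    by (fast dest: choice)
  obtain p where p: "\<And>i. p i < m" "\<And>i. r i (p i) = q"
  proof -
    have "\<exists>a. a < m \<and> r i a = q" for i using r(2)[of i] by auto
    then have "\<forall>i. \<exists>a. a < m \<and> r i a = q" ..
    from choice[OF this] that show ?thesis by blast
  qed
  obtain s where s: "\<And>i. s i < m" "\<And>i. r i (s i) = i"
  proof -
    have "\<exists>a. a < m \<and> r i a = i" for i using r(3)[of i] by auto
    then have "\<forall>i. \<exists>a. a < m \<and> r i a = i" ..
    from choice[OF this] that show ?thesis by blast
  qed
  obtain c where c: "\<And>i. Determinant.det (submat m A0 (r i) (c i)) \<noteq> 0"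
  proof -
    have "\<forall>i. \<exists>c. Determinant.det (submat m A0 (r i) c) \<noteq> 0"
      using exists_nonzero_submat[OF A0(2) r(1)] by blast
    from choice[OF this] that show ?thesis by blast
  qed
  define d where "d i x = Determinant.det (adj_minors m (G x) (r i) (c i))" for i x
  define F where "F i a j x = row_factor m (G x) (r i) (c i) a j" for i a j x
  have d_det: "d i x = Determinant.det (submat m A (r i) (c i)) ^ k"
    if "kminor k A = G x" "Determinant.det (submat m A (r i) (c i)) \<noteq> 0" for i x A
    using that det_adj_mat[of "submat m A (r i) (c i)" k] adj_submat[of k A "r i" "c i"]
    by (simp add: d_def m_def)
  \<comment> \<open>The neighbourhood is found from \<open>G\<close> alone, so
    \<open>d i x \<noteq> 0\<close> has to exclude a singular submatrix \<open>M\<close> for every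
    \<open>A\<close> with these minors. Singularity would give \<open>M = 0\<close> by
    \<open>adj_adj_mat\<close>, then \<open>adj_mat M = 0\<close> because \<open>k \<ge> 1\<close>,
    and finally \<open>d i x = 0\<close>.\<close>
  have t_nz: "Determinant.det (submat m A (r i) (c i)) \<noteq> 0"
    if A: "kminor k A = G x" and d: "d i x \<noteq> 0" for i x A
  proof
    assume 0: "Determinant.det (submat m A (r i) (c i)) = 0"
    define M where "M = submat m A (r i) (c i)"
    have M: "M \<in> carrier_mat m m" by (simp add: M_def)
    have N: "adj_mat M = adj_minors m (G x) (r i) (c i)"
      using adj_submat[of k A "r i" "c i"] A by (simp add: M_def m_def)
    have "M $$ (a,b) = 0" if "a < m" "b < m" for a b
      using adj_adj_mat[OF M that, unfolded N] 0 d by (simp add: M_def[symmetric] d_def)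
    then have M0: "M = 0\<^sub>m m m" using M by (intro eq_matI) auto
    have "adj_mat M $$ (a,b) = 0" if "a < m" "b < m" for a b
    proof -
      have "mat_delete M b a = 0\<^sub>m k k"
        using that by (intro eq_matI) (auto simp: M0 mat_delete_def m_def)
      moreover have "Determinant.det (0\<^sub>m k k :: real mat) = 0"
        using k(1) by (simp add: det_zero)
      ultimately show ?thesis using that M by (auto simp: adj_mat_def cofactor_def)
    qed
    then have "adj_minors m (G x) (r i) (c i) = 0\<^sub>m m m" unfolding N[symmetric]
      using adj_mat(1)[OF M] by (intro eq_matI) auto
    moreover have "Determinant.det (0\<^sub>m m m :: real mat) = 0" using m2 by (simp add: det_zero)
    ultimately show False using d by (simp add: d_def)
  qed
  have entry: "A $ r i a $ j = Determinant.det (submat m A (r i) (c i)) * F i a j x"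
    if "kminor k A = G x" "d i x \<noteq> 0" "a < m" for A x i a j
    using entry_eq_row_factor[of k a A "r i" "c i" j] k(1) that t_nz[OF that(1,2)] by (simp add: F_def m_def)
  have d0: "d i x0 \<noteq> 0" for i using d_det[OF A0(1) c] c by simp
  \<comment> \<open>The entry at \<open>(q, j0)\<close> will be the common factor
    \<open>\<tau>\<close>; every row set \<open>r i\<close> contains \<open>q\<close>, so each
    submatrix computes it.\<close>
  obtain j0 where j0: "A0 $ q $ j0 \<noteq> 0"
  proof -
    have "row q A0 \<noteq> 0" using det_zero_row(1)[of q A0] A0(2) by blast
    then have "A0 $ q \<noteq> 0" by (simp add: row_def)
    then have "\<exists>j. A0 $ q $ j \<noteq> 0 $ j" unfolding vec_eq_iff by blast
    then show ?thesis using that by auto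
  qed
  have F0: "F i (p i) j0 x0 \<noteq> 0" for i
    using entry[OF A0(1) d0 p(1), of i i j0] j0 p(2)[of i] by auto
  \<comment> \<open>Two stages: where all \<open>d i\<close> are nonzero the \<open>F i\<close> are
    smooth, and only then is nonvanishing of the \<open>F i\<close> an open condition.\<close>
  define W1 where "W1 = (\<Inter>i. {x \<in> U. d i x \<noteq> 0})"
  have smd: "smooth_on U (d i)" for i unfolding d_def[abs_def] by (rule smooth_on_adj_minors(1)[OF U G])
  have W1: "open W1" "W1 \<subseteq> U" "x0 \<in> W1"
    unfolding W1_def using x0 d0 by (auto intro!: open_INT open_nonzero_smooth[OF U smd])
  have smF: "smooth_on W1 (F i a j)" if "a < m" for i a j
    unfolding F_def[abs_def]
    by (rule smooth_on_row_factor[OF W1(1) smooth_on_subset[OF G W1(1,2)] m2 that])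
      (auto simp: W1_def d_def)
  define W where "W = (\<Inter>i. {x \<in> W1. F i (p i) j0 x \<noteq> 0})"
  have W: "open W" "W \<subseteq> W1" "x0 \<in> W"
    unfolding W_def using W1(3) F0 by (auto intro!: open_INT open_nonzero_smooth[OF W1(1) smF] p)
  have F_nz: "F i (p i) j0 x \<noteq> 0" if "x \<in> W" for i x using that by (auto simp: W_def)
  have d_nz: "d i x \<noteq> 0" if "x \<in> W" for i x using that W(2) by (auto simp: W1_def)
  \<comment> \<open>Row \<open>i\<close> of \<open>A\<close> divided by the entry at
    \<open>(q, j0)\<close>, both computed from the row set \<open>r i\<close>, so that the unknown
    determinant cancels. Below, \<open>g\<close> is the \<open>k\<close>-th power of that entry
    computed from the row set \<open>r q\<close>.\<close>
  define S :: "real^'n \<Rightarrow> real^'n^'n" where "S x = (\<chi> i j. F i (s i) j x / F i (p i) j0 x)" for x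
  define g where "g x = d q x * F q (p q) j0 x ^ k" for x
  show thesis
  proof (rule that[of W g S])
    show "open W" "x0 \<in> W" "W \<subseteq> U" using W W1 by auto
    show "smooth_on W g" unfolding g_def[abs_def]
      by (intro smooth_on_mult smooth_on_power W(1) smooth_on_subset[OF smd] smooth_on_subset[OF smF] p W(2))
        (use W W1 in auto)
    show "smooth_on W (\<lambda>x. S x $ i $ j)" for i j
      using smooth_on_divide[OF W(1) smooth_on_subset[OF smF W(1,2)] smooth_on_subset[OF smF W(1,2)] F_nz] p s
      by (simp add: S_def)
    fix x A assume x: "x \<in> W" and A: "kminor k A = G x"
    define \<tau> where "\<tau> = A $ q $ j0"
    have \<tau>: "\<tau> = Determinant.det (submat m A (r i) (c i)) * F i (p i) j0 x" for i
      using entry[OF A d_nz[OF x] p(1), of i i j0] by (simp add: \<tau>_def p(2))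
    have "A $ i $ j = \<tau> * (F i (s i) j x / F i (p i) j0 x)" for i j
      using entry[OF A d_nz[OF x] s(1), of i i j] F_nz[OF x, of i] by (simp add: \<tau>[of i] s(2))
    then have "A = \<tau> *\<^sub>R S x" by (simp add: vec_eq_iff S_def)
    moreover have "\<tau> ^ k = g x"
      using d_det[OF A t_nz[OF A d_nz[OF x]], of q] by (simp add: \<tau>[of q] g_def power_mult_distrib)
    moreover have "g x \<noteq> 0" using d_nz[OF x] F_nz[OF x] by (simp add: g_def)
    ultimately show "\<exists>\<tau>. A = \<tau> *\<^sub>R S x \<and> \<tau> ^ k = g x \<and> g x \<noteq> 0" by blast
  qed
qed

section \<open>The sign of the common factor\<close>

lemma det_scaleR: "det (c *\<^sub>R A) = c ^ CARD('n) * det A" for A :: "real^'n^'n"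
  by (simp add: Determinants.det_def prod.distrib sum_distrib_left mult_ac)

text \<open>The modulus of \<open>\<tau>\<close> is the \<open>k\<close>-th root of
  \<open>\<bar>g\<bar>\<close>, so only its sign is open, and near \<open>x0\<close> this is one
  constant. The prescribed sign \<open>\<epsilon>\<close> of the determinant enters for even
  \<open>k\<close> only.\<close>

lemma local_smooth_differential:
  fixes G :: "real^'n \<Rightarrow> (nat \<Rightarrow> 'n) \<Rightarrow> (nat \<Rightarrow> 'n) \<Rightarrow> real" and A0 :: "real^'n^'n"
  assumes U: "open U" and x0: "x0 \<in> U" and k: "1 \<le> k" "k < CARD('n)"
    and G: "\<And>r c. smooth_on U (\<lambda>x. G x r c)"
    and A0: "kminor k A0 = G x0" "det A0 \<noteq> 0"
    and odd: "odd k \<or> odd (CARD('n))"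
  obtains W B where "open W" "x0 \<in> W" "W \<subseteq> U" "\<And>i j. smooth_on W (\<lambda>x. B x $ i $ j)"
    "\<And>x A. x \<in> W \<Longrightarrow> kminor k A = G x \<Longrightarrow> (even k \<Longrightarrow> sgn (det A) = \<epsilon>) \<Longrightarrow> A = B x"
proof -
  obtain W0 S g where W0: "open W0" "x0 \<in> W0" "W0 \<subseteq> U" and g: "smooth_on W0 g"
    and S: "\<And>i j. smooth_on W0 (\<lambda>x. S x $ i $ j)"
    and fac: "\<And>x A. x \<in> W0 \<Longrightarrow> kminor k A = G x \<Longrightarrow> \<exists>\<tau>. A = \<tau> *\<^sub>R S x \<and> \<tau> ^ k = g x \<and> g x \<noteq> 0"
    by (rule local_smooth_factor[OF U x0 k G A0]) blast
  have smdet: "smooth_on W0 (\<lambda>x. det (S x))"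
    unfolding Determinants.det_def by (intro smooth_on_sum smooth_on_mult smooth_on_const smooth_on_prod S W0)
  obtain \<tau>0 where "A0 = \<tau>0 *\<^sub>R S x0" "g x0 \<noteq> 0" using fac[OF W0(2) A0(1)] by blast
  then have nz: "g x0 \<noteq> 0" "det (S x0) \<noteq> 0" using A0(2) by (auto simp: det_scaleR)
  \<comment> \<open>Multiplication by the signs at \<open>x0\<close> turns constancy of the two
    signs into positivity, an open condition.\<close>
  define W where "W = {x \<in> W0. 0 < sgn (g x0) * g x} \<inter> {x \<in> W0. 0 < sgn (det (S x0)) * det (S x)}"
  have opn: "open {x \<in> W0. 0 < c * f x}" if "smooth_on W0 f" for c f
  proof -
    have "continuous_on W0 (\<lambda>x. c * f x)" by (intro continuous_intros smooth_on_imp_continuous_on[OF that])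
    then have "open (W0 \<inter> (\<lambda>x. c * f x) -` {0<..})" by (intro continuous_open_preimage W0) auto
    moreover have "W0 \<inter> (\<lambda>x. c * f x) -` {0<..} = {x \<in> W0. 0 < c * f x}" by auto
    ultimately show ?thesis by simp
  qed
  have W: "open W" unfolding W_def by (intro open_Int opn g smdet)
  have W0W: "W \<subseteq> W0" "x0 \<in> W" using W0(2) nz by (auto simp: W_def sgn_real_def)
  have sg: "sgn (g x) = sgn (g x0)" "sgn (det (S x)) = sgn (det (S x0))" if "x \<in> W" for x
    using that by (auto simp: W_def sgn_real_def split: if_splits)
  \<comment> \<open>For odd \<open>k\<close> the sign of \<open>\<tau>\<close> is that of
    \<open>\<tau> ^ k = g\<close>. For even \<open>k\<close> the dimension is odd, so
    \<open>\<epsilon> = sgn \<tau> * sgn (det S)\<close>, and a nonzero sign is its own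
    inverse.\<close>
  define \<sigma> where "\<sigma> = (if odd k then sgn (g x0) else \<epsilon> * sgn (det (S x0)))"
  \<comment> \<open>On \<open>W\<close> the base of the power is \<open>\<bar>g\<bar> > 0\<close>,
    which keeps the root smooth.\<close>
  define B :: "real^'n \<Rightarrow> real^'n^'n" where "B x = (\<sigma> * (sgn (g x0) * g x) powr (1 / real k)) *\<^sub>R S x" for x
  show thesis
  proof (rule that[of W B])
    show "open W" "x0 \<in> W" "W \<subseteq> U" using W W0 W0W by auto
    show "smooth_on W (\<lambda>x. B x $ i $ j)" for i j
    proof -
      have "smooth_on W (\<lambda>x. (\<sigma> * (sgn (g x0) * g x) powr (1 / real k)) * S x $ i $ j)"
        by (intro smooth_on_mult smooth_on_const smooth_on_powr W
            smooth_on_subset[OF g W W0W(1)] smooth_on_subset[OF S W W0W(1)]) (simp add: W_def)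
      then show ?thesis by (simp add: B_def)
    qed
    fix x A assume x: "x \<in> W" and A: "kminor k A = G x" and ev: "even k \<Longrightarrow> sgn (det A) = \<epsilon>"
    obtain \<tau> where \<tau>: "A = \<tau> *\<^sub>R S x" "\<tau> ^ k = g x" "g x \<noteq> 0" using fac[OF _ A] x W0W(1) by blast
    have abs: "\<bar>\<tau>\<bar> = (sgn (g x0) * g x) powr (1 / real k)"
    proof -
      have "sgn (g x0) * g x = \<bar>g x\<bar>" using sg(1)[OF x] by (simp add: abs_sgn mult.commute)
      also have "\<dots> = \<bar>\<tau>\<bar> ^ k" by (simp add: \<tau>(2)[symmetric] power_abs)
      also have "\<dots> = \<bar>\<tau>\<bar> powr real k" using \<tau>(2,3) k(1) by (subst powr_realpow) (auto simp: zero_power)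
      finally have "(sgn (g x0) * g x) powr (1 / real k) = (\<bar>\<tau>\<bar> powr real k) powr (1 / real k)" by simp
      also have "\<dots> = \<bar>\<tau>\<bar>" using k(1) by (simp add: powr_powr)
      finally show ?thesis by simp
    qed
    have sgn_odd: "sgn (t ^ n) = sgn t" if "odd n" for t :: real and n :: nat
    proof -
      have "sgn t ^ n = sgn t" using that by (cases "t = 0"; cases "t > 0") (auto simp: sgn_real_def odd_pos)
      then show ?thesis by (simp add: power_sgn)
    qed
    have "sgn \<tau> = \<sigma>"
    proof (cases "odd k")
      case True
      then show ?thesis using sgn_odd[OF True, of \<tau>] \<tau>(2) sg(1)[OF x] by (simp add: \<sigma>_def)
    next
      case False
      have "\<epsilon> = sgn (\<tau> ^ CARD('n) * det (S x))" using ev False by (simp add: \<tau>(1) det_scaleR)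
      also have "\<dots> = sgn \<tau> * sgn (det (S x0))"
        using odd False sgn_odd[of "CARD('n)" \<tau>] sg(2)[OF x] by (simp add: sgn_mult)
      finally show ?thesis using False nz(2) by (auto simp: \<sigma>_def sgn_real_def)
    qed
    then have "\<tau> = \<sigma> * (sgn (g x0) * g x) powr (1 / real k)"
      using abs by (metis sgn_mult_abs)
    then show "A = B x" using \<tau>(1) by (simp add: B_def)
  qed
qed

section \<open>Sobolev functions with locally smooth differential\<close>

text \<open>Since \<open>p \<ge> 1\<close>,
  \<open>\<bar>g\<bar> \<le> 1 + \<bar>g\<bar> powr p\<close>, and the constant is integrable over
  the bounded box.\<close>

lemma Lp_on_indicator_integrable:
  assumes g: "Lp_on p \<Omega> g" and p: "p \<ge> 1" and \<Omega>: "open \<Omega>" and Q: "Q = cbox a b" "Q \<subseteq> \<Omega>"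
  shows "integrable lebesgue (\<lambda>x. indicator Q x * g x)"
proof (rule Bochner_Integration.integrable_bound)
  have m\<Omega>: "\<Omega> \<inter> space lebesgue \<in> sets lebesgue" using \<Omega> by (auto intro: sets_completionI_sets)
  have mQ: "Q \<in> sets lebesgue" unfolding Q(1) by simp
  have gm: "(\<lambda>x. indicator \<Omega> x *\<^sub>R g x) \<in> borel_measurable lebesgue"
    using g borel_measurable_restrict_space_iff[OF m\<Omega>, of g] by (simp add: Lp_on_def)
  have gi: "integrable lebesgue (\<lambda>x. indicator \<Omega> x *\<^sub>R (\<bar>g x\<bar> powr p))"
    using g integrable_restrict_space[OF m\<Omega>, of "\<lambda>x. \<bar>g x\<bar> powr p"] by (simp add: Lp_on_def)
  have Qi: "integrable lebesgue (indicator Q :: _ \<Rightarrow> real)"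
    unfolding Q(1) using integrable_indicator_cbox[of a b] by (subst integrable_completion) auto
  show "integrable lebesgue (\<lambda>x. indicator Q x + indicator \<Omega> x *\<^sub>R (\<bar>g x\<bar> powr p))"
    by (intro Bochner_Integration.integrable_add Qi gi)
  have "(\<lambda>x. indicator Q x * (indicator \<Omega> x *\<^sub>R g x)) \<in> borel_measurable lebesgue"
    by (intro borel_measurable_times borel_measurable_indicator mQ gm)
  moreover have "(\<lambda>x. indicator Q x * (indicator \<Omega> x *\<^sub>R g x)) = (\<lambda>x. indicator Q x * g x)"
    using Q(2) by (auto simp: indicator_def fun_eq_iff)
  ultimately show "(\<lambda>x. indicator Q x * g x) \<in> borel_measurable lebesgue" by simp
  show "AE x in lebesgue. norm (indicator Q x * g x) \<le> norm (indicator Q x + indicator \<Omega> x *\<^sub>R (\<bar>g x\<bar> powr p))"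
  proof (rule AE_I2)
    fix x
    have "\<bar>g x\<bar> \<le> 1 + \<bar>g x\<bar> powr p"
    proof (cases "\<bar>g x\<bar> \<le> 1")
      case True
      then show ?thesis using powr_ge_zero[of "\<bar>g x\<bar>" p] by linarith
    next
      case False
      then have "\<bar>g x\<bar> powr 1 \<le> \<bar>g x\<bar> powr p" using p by (intro powr_mono) auto
      then show ?thesis using False by simp
    qed
    then show "norm (indicator Q x * g x) \<le> norm (indicator Q x + indicator \<Omega> x *\<^sub>R (\<bar>g x\<bar> powr p))"
      using Q(2) by (auto simp: indicator_def)
  qed
qed

lemma exists_cbox_subset_open:
  fixes x0 :: "real^'n"
  assumes "open W" "x0 \<in> W"
  obtains R where "R > 0" "cbox (x0 - (\<chi> i. 2 * R)) (x0 + (\<chi> i. 2 * R)) \<subseteq> W"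
proof -
  obtain r where r: "r > 0" "cball x0 r \<subseteq> W" using assms open_contains_cball by blast
  \<comment> \<open>Coordinates deviate from the centre by at most
    \<open>2 * R = r / CARD('n)\<close>, so their sum is at most \<open>r\<close>.\<close>
  define R where "R = r / (2 * real CARD('n))"
  have "dist x0 x \<le> r" if x: "x \<in> cbox (x0 - (\<chi> i. 2 * R)) (x0 + (\<chi> i. 2 * R))" for x
  proof -
    have "norm (x - x0) \<le> (\<Sum>i\<in>UNIV. \<bar>(x - x0) $ i\<bar>)" by (rule norm_le_l1_cart)
    also have "\<dots> \<le> (\<Sum>i\<in>(UNIV::'n set). 2 * R)"
    proof (rule sum_mono)
      fix i
      have "x0 $ i - 2 * R \<le> x $ i" "x $ i \<le> x0 $ i + 2 * R" using x by (auto simp: mem_box_cart)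
      then show "\<bar>(x - x0) $ i\<bar> \<le> 2 * R" by (simp add: abs_le_iff)
    qed
    also have "\<dots> = r" by (simp add: R_def)
    finally show ?thesis by (simp add: dist_norm norm_minus_commute)
  qed
  then have "cbox (x0 - (\<chi> i. 2 * R)) (x0 + (\<chi> i. 2 * R)) \<subseteq> W" using r(2) by auto
  moreover have "R > 0" using r(1) by (simp add: R_def)
  ultimately show ?thesis by (rule that[rotated])
qed

text \<open>Each component has a version whose classical partial derivatives are entries of
  \<open>B\<close>. These are smooth, so one application of the \<open>C^1\<close> result yields
  smoothness of all orders.\<close>

lemma sobolev_local_smooth:
  fixes f :: "real^'n \<Rightarrow> real^'n" and B :: "real^'n \<Rightarrow> real^'n^'n"
  assumes \<Omega>: "open \<Omega>" and p: "p \<ge> 1" and f: "sobolev_W1p p \<Omega> f Df"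
    and W: "open W" "W \<subseteq> \<Omega>" "x0 \<in> W" and B: "\<And>i j. smooth_on W (\<lambda>x. B x $ i $ j)"
    and eq: "AE x in lebesgue. x \<in> W \<longrightarrow> Df x = B x"
  obtains V h where "open V" "x0 \<in> V" "V \<subseteq> W" "\<And>i. smooth_on V (\<lambda>x. h x $ i)"
    "AE x in lebesgue. x \<in> V \<longrightarrow> f x = h x"
proof -
  obtain R where R: "R > 0" and QW': "cbox (x0 - (\<chi> i. 2 * R)) (x0 + (\<chi> i. 2 * R)) \<subseteq> W"
    by (rule exists_cbox_subset_open[OF W(1,3)])
  define Q where "Q = cbox (x0 - (\<chi> i. 2 * R)) (x0 + (\<chi> i. 2 * R))"
  define V where "V = box (x0 - (\<chi> i. R)) (x0 + (\<chi> i. R))"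
  have QW: "Q \<subseteq> W" using QW' by (simp add: Q_def)
  have VQ: "V \<subseteq> Q" using R by (auto simp: V_def Q_def mem_box_cart) (smt (verit))+
  have mQ: "Q \<in> sets lebesgue" by (simp add: Q_def)
  have m\<Omega>: "\<Omega> \<inter> space lebesgue \<in> sets lebesgue" using \<Omega> by (auto intro: sets_completionI_sets)
  have ex: "\<exists>h. (\<forall>x\<in>V. (h has_derivative (\<lambda>v. \<Sum>j\<in>UNIV. v $ j * B x $ i $ j)) (at x)) \<and>
      (AE x in lebesgue. x \<in> V \<longrightarrow> f x $ i = h x)" for i
  proof -
    have intf: "integrable lebesgue (\<lambda>x. indicator Q x * f x $ i)"
      by (rule Lp_on_indicator_integrable[OF _ p \<Omega> Q_def]) (use f QW W(2) in \<open>auto simp: sobolev_W1p_def\<close>)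
    have intD: "integrable lebesgue (\<lambda>x. indicator Q x * Df x $ i $ j)" for j
      by (rule Lp_on_indicator_integrable[OF _ p \<Omega> Q_def]) (use f QW W(2) in \<open>auto simp: sobolev_W1p_def\<close>)
    \<comment> \<open>A Borel version of the Lebesgue measurable component, cut off to the cube,
      since the mollification argument runs over \<open>lborel\<close>.\<close>
    obtain u where um: "u \<in> borel_measurable lborel" and u: "AE x in lborel. indicator Q x * f x $ i = u x"
      using completion_ex_borel_measurable_real[OF borel_measurable_integrable[OF intf]] by blast
    have u': "AE x in lebesgue. indicator Q x * f x $ i = u x" by (rule AE_completion[OF u])
    have uml: "u \<in> borel_measurable lebesgue" using um by (rule measurable_completion)
    have "integrable lebesgue u"
      using intf u' uml by (subst integrable_cong_AE[of _ _ "\<lambda>x. indicator Q x * f x $ i"]) auto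
    then have intu: "integrable lborel u" using um by (simp add: integrable_completion)
    have cB: "continuous_on Q (\<lambda>x. B x $ i $ j)" for j
      using smooth_on_imp_continuous_on[OF B] QW by (rule continuous_on_subset)
    have weak: "(\<integral>x. u x * frechet_derivative \<phi> (at x) (axis j 1) \<partial>lborel)
        = - (\<integral>x. indicator Q x * B x $ i $ j * \<phi> x \<partial>lborel)"
      if \<phi>: "smooth_on UNIV \<phi>" "\<And>x. x \<notin> Q \<Longrightarrow> \<phi> x = 0" for \<phi> j
    proof -
      define d where "d x = frechet_derivative \<phi> (at x) (axis j 1)" for x
      have contd: "continuous_on UNIV d"
        unfolding d_def by (rule smooth_on_imp_continuous_on[OF smooth_on_partial[OF \<phi>(1)]])
      have d0: "d x = 0" if "x \<notin> Q" for x
        unfolding d_def by (rule partial_bounded_support[OF _ \<phi>(2) that]) (simp add: Q_def compact_imp_closed)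
      have bm: "d \<in> borel_measurable borel" "\<phi> \<in> borel_measurable borel"
        using borel_measurable_continuous_onI[OF contd]
          borel_measurable_continuous_onI[OF smooth_on_imp_continuous_on[OF \<phi>(1)]] by auto
      have blm: "d \<in> borel_measurable lebesgue" "\<phi> \<in> borel_measurable lebesgue"
        using bm by (auto intro: measurable_completion)
      have "test_function \<Omega> \<phi>"
        unfolding test_function_def using \<phi> QW W(2) by (auto simp: Q_def intro!: exI[of _ Q])
      then have "(\<integral>x. f x $ i * d x \<partial>lebesgue_on \<Omega>) = - (\<integral>x. Df x $ i $ j * \<phi> x \<partial>lebesgue_on \<Omega>)"
        using f unfolding sobolev_W1p_def weak_differential_def d_def by blast
      then have main: "(\<integral>x. indicator \<Omega> x *\<^sub>R (f x $ i * d x) \<partial>lebesgue)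
          = - (\<integral>x. indicator \<Omega> x *\<^sub>R (Df x $ i $ j * \<phi> x) \<partial>lebesgue)"
        by (simp only: integral_restrict_space[OF m\<Omega>])
      have "(\<integral>x. indicator \<Omega> x *\<^sub>R (f x $ i * d x) \<partial>lebesgue) = (\<integral>x. (indicator Q x * f x $ i) * d x \<partial>lebesgue)"
        using QW W(2) d0 by (intro Bochner_Integration.integral_cong) (auto simp: indicator_def)
      also have "\<dots> = (\<integral>x. u x * d x \<partial>lebesgue)"
      proof (rule integral_cong_AE)
        show "AE x in lebesgue. (indicator Q x * f x $ i) * d x = u x * d x"
          using u' by eventually_elim simp
      qed (intro borel_measurable_times blm uml borel_measurable_integrable[OF intf])+
      also have "\<dots> = (\<integral>x. u x * d x \<partial>lborel)"
        using um bm by (intro integral_completion) auto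
      finally have L: "(\<integral>x. indicator \<Omega> x *\<^sub>R (f x $ i * d x) \<partial>lebesgue) = (\<integral>x. u x * d x \<partial>lborel)" .
      have bB: "(\<lambda>x. indicator Q x * B x $ i $ j) \<in> borel_measurable borel"
        using borel_measurable_continuous_on_indicator[OF _ cB, of j] by (simp add: Q_def)
      then have bBl: "(\<lambda>x. indicator Q x * B x $ i $ j) \<in> borel_measurable lebesgue"
        by (intro measurable_completion) simp
      have "(\<integral>x. indicator \<Omega> x *\<^sub>R (Df x $ i $ j * \<phi> x) \<partial>lebesgue)
          = (\<integral>x. (indicator Q x * Df x $ i $ j) * \<phi> x \<partial>lebesgue)"
        using QW W(2) \<phi>(2) by (intro Bochner_Integration.integral_cong) (auto simp: indicator_def)
      also have "\<dots> = (\<integral>x. indicator Q x * B x $ i $ j * \<phi> x \<partial>lebesgue)"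
      proof (rule integral_cong_AE)
        show "AE x in lebesgue. (indicator Q x * Df x $ i $ j) * \<phi> x = indicator Q x * B x $ i $ j * \<phi> x"
          using eq by eventually_elim (use QW in \<open>auto simp: indicator_def\<close>)
      qed (intro borel_measurable_times blm bBl borel_measurable_integrable[OF intD])+
      also have "\<dots> = (\<integral>x. indicator Q x * B x $ i $ j * \<phi> x \<partial>lborel)"
        using bB bm by (intro integral_completion) (simp add: borel_measurable_times)
      finally show ?thesis using main L by (simp add: d_def)
    qed
    have "\<exists>h. (\<forall>x\<in>V. (h has_derivative (\<lambda>v. \<Sum>j\<in>UNIV. v $ j * B x $ i $ j)) (at x)) \<and>
        (AE x in lborel. x \<in> V \<longrightarrow> u x = h x)"
      unfolding V_def
      by (rule weak_gradient_continuous_imp_C1[OF R intu]) (use cB weak in \<open>simp_all add: Q_def\<close>)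
    then obtain h where h: "\<And>x. x \<in> V \<Longrightarrow> (h has_derivative (\<lambda>v. \<Sum>j\<in>UNIV. v $ j * B x $ i $ j)) (at x)"
      and ae: "AE x in lborel. x \<in> V \<longrightarrow> u x = h x" by blast
    have "AE x in lebesgue. x \<in> V \<longrightarrow> f x $ i = h x"
      using u' AE_completion[OF ae] by eventually_elim (use VQ in auto)
    with h show ?thesis by blast
  qed
  have "\<exists>H. \<forall>i. (\<forall>x\<in>V. (H i has_derivative (\<lambda>v. \<Sum>j\<in>UNIV. v $ j * B x $ i $ j)) (at x)) \<and>
      (AE x in lebesgue. x \<in> V \<longrightarrow> f x $ i = H i x)"
    using ex by (intro choice allI)
  then obtain H where H: "\<And>i x. x \<in> V \<Longrightarrow> (H i has_derivative (\<lambda>v. \<Sum>j\<in>UNIV. v $ j * B x $ i $ j)) (at x)"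
    and ae: "\<And>i. AE x in lebesgue. x \<in> V \<longrightarrow> f x $ i = H i x" by blast
  have oV: "open V" unfolding V_def by (rule open_box)
  show thesis
  proof (rule that[of V "\<lambda>x. \<chi> i. H i x"])
    show "x0 \<in> V" using R by (simp add: V_def mem_box_cart)
    show "V \<subseteq> W" using VQ QW by blast
    show "smooth_on V (\<lambda>x. (\<chi> i. H i x) $ i)" for i
    proof -
      have "(\<Sum>l\<in>UNIV. axis j 1 $ l * B x $ i $ l) = B x $ i $ j" for j x
        by (simp add: axis_def if_distrib[of "\<lambda>t. t * _"] cong: if_cong)
      moreover have "smooth_on V (\<lambda>x. B x $ i $ j)" for j
        using B oV VQ QW by (intro smooth_on_subset[OF B]) auto
      ultimately have "smooth_on V (H i)"
        by (intro smooth_onI[OF oV H]) simp_all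
      then show ?thesis by simp
    qed
    have "AE x in lebesgue. \<forall>i\<in>UNIV. x \<in> V \<longrightarrow> f x $ i = H i x"
      by (intro AE_finite_allI ae) simp
    then show "AE x in lebesgue. x \<in> V \<longrightarrow> f x = (\<chi> i. H i x)"
      by eventually_elim (simp add: vec_eq_iff)
  qed (rule oV)
qed

section \<open>Gluing local smooth versions\<close>

lemma AE_eq_continuous_imp_eq:
  fixes g h :: "'a::euclidean_space \<Rightarrow> 'b::euclidean_space"
  assumes U: "open U" and g: "continuous_on U g" and h: "continuous_on U h"
    and ae: "AE x in lebesgue. x \<in> U \<longrightarrow> g x = h x" and x: "x \<in> U"
  shows "g x = h x"
proof (rule ccontr)
  assume ne: "g x \<noteq> h x"
  define N where "N = U \<inter> (\<lambda>x. g x - h x) -` (- {0})"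
  have N: "open N" unfolding N_def by (intro continuous_open_preimage continuous_on_diff g h U) auto
  have "AE x in lebesgue. x \<notin> N" using ae by eventually_elim (auto simp: N_def)
  then have "N \<in> null_sets lebesgue" using N by (subst AE_iff_null_sets) auto
  then have "N = {}" using open_not_negligible[OF N] by (auto simp: negligible_iff_null_sets)
  with x ne show False by (auto simp: N_def)
qed

text \<open>On overlaps two local versions agree almost everywhere, hence everywhere by continuity,
  so they patch to one function.\<close>

lemma glue_local_smooth_versions:
  fixes f :: "real^'n \<Rightarrow> real^'m"
  assumes \<Omega>0: "open \<Omega>0"
    and loc: "\<And>x. x \<in> \<Omega>0 \<Longrightarrow> \<exists>V h. open V \<and> x \<in> V \<and> (\<forall>i. smooth_on V (\<lambda>x. h x $ i)) \<and>
      (AE y in lebesgue. y \<in> V \<longrightarrow> f y = h y)"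
  shows "\<exists>g :: real^'n \<Rightarrow> real^'m. (\<forall>i. smooth_on \<Omega>0 (\<lambda>x. g x $ i)) \<and> (AE x in lebesgue. x \<in> \<Omega>0 \<longrightarrow> f x = g x)"
proof -
  have "\<exists>Vh. x \<in> \<Omega>0 \<longrightarrow> open (fst Vh) \<and> x \<in> fst Vh \<and> (\<forall>i. smooth_on (fst Vh) (\<lambda>x. snd Vh x $ i)) \<and>
      (AE y in lebesgue. y \<in> fst Vh \<longrightarrow> f y = snd Vh y)" for x
  proof (cases "x \<in> \<Omega>0")
    case True
    from loc[OF this] obtain V and h :: "real^'n \<Rightarrow> real^'m" where "open V" "x \<in> V"
      "\<forall>i. smooth_on V (\<lambda>x. h x $ i)" "AE y in lebesgue. y \<in> V \<longrightarrow> f y = h y" by blast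
    then show ?thesis by (intro exI[of _ "(V, h)"]) simp
  qed simp
  then have "\<forall>x. \<exists>Vh. x \<in> \<Omega>0 \<longrightarrow> open (fst Vh) \<and> x \<in> fst Vh \<and> (\<forall>i. smooth_on (fst Vh) (\<lambda>x. snd Vh x $ i)) \<and>
      (AE y in lebesgue. y \<in> fst Vh \<longrightarrow> f y = snd Vh y)" ..
  from choice[OF this] obtain Vh where Vh: "\<And>x. x \<in> \<Omega>0 \<Longrightarrow> open (fst (Vh x)) \<and> x \<in> fst (Vh x) \<and>
      (\<forall>i. smooth_on (fst (Vh x)) (\<lambda>y. snd (Vh x) y $ i)) \<and>
      (AE y in lebesgue. y \<in> fst (Vh x) \<longrightarrow> f y = snd (Vh x) y)" by blast
  define V where "V x = fst (Vh x)" for x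
  define h where "h x = snd (Vh x)" for x
  have V: "open (V x)" "x \<in> V x" and h: "\<And>i. smooth_on (V x) (\<lambda>y. h x y $ i)"
    and ae: "AE y in lebesgue. y \<in> V x \<longrightarrow> f y = h x y" if "x \<in> \<Omega>0" for x
    using Vh[OF that] by (auto simp: V_def h_def)
  have ch: "continuous_on (V x) (h x)" if "x \<in> \<Omega>0" for x
    using continuous_on_vec_lambda[of "V x" "\<lambda>i y. h x y $ i"] smooth_on_imp_continuous_on[OF h[OF that]]
    by simp
  \<comment> \<open>At each point the version attached to that very point is used; \<open>gh\<close>
    shows that near \<open>x\<close> this is the single function \<open>h x\<close>.\<close>
  define g where "g x = h x x" for x
  have gh: "g y = h x y" if x: "x \<in> \<Omega>0" and y: "y \<in> \<Omega>0" "y \<in> V x" for x y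
    unfolding g_def
  proof (rule AE_eq_continuous_imp_eq[of "V x \<inter> V y" "h y" "h x"])
    show "AE z in lebesgue. z \<in> V x \<inter> V y \<longrightarrow> h y z = h x z"
      using ae[OF x] ae[OF y(1)] by eventually_elim auto
  qed (use V[OF x] V[OF y(1)] ch[OF x] ch[OF y(1)] y in \<open>auto intro: continuous_on_subset\<close>)
  have "smooth_on \<Omega>0 (\<lambda>x. g x $ i)" for i
  proof (rule smooth_on_local)
    fix x assume x: "x \<in> \<Omega>0"
    have o: "open (V x \<inter> \<Omega>0)" using V(1)[OF x] \<Omega>0 by auto
    have "smooth_on (V x \<inter> \<Omega>0) (\<lambda>y. h x y $ i)" by (rule smooth_on_subset[OF h[OF x] o]) auto
    then have "smooth_on (V x \<inter> \<Omega>0) (\<lambda>x. g x $ i)"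
      by (rule smooth_on_cong[OF o]) (use gh[OF x] in auto)
    with o V(2)[OF x] x show "\<exists>W. open W \<and> x \<in> W \<and> smooth_on W (\<lambda>x. g x $ i)" by blast
  qed
  moreover have "AE x in lebesgue. x \<in> \<Omega>0 \<longrightarrow> f x = g x"
  proof -
    \<comment> \<open>A countable subcover keeps the union of the exceptional sets null.\<close>
    obtain \<F> where \<F>: "\<F> \<subseteq> V ` \<Omega>0" "countable \<F>" "\<Union>\<F> = \<Union>(V ` \<Omega>0)"
      by (rule Lindelof[of "V ` \<Omega>0"]) (use V(1) in auto)
    obtain I where I: "countable I" "I \<subseteq> \<Omega>0" "\<F> = V ` I"
      using \<F>(1,2) by (metis countable_subset_image)
    have "AE y in lebesgue. \<forall>x\<in>I. y \<in> V x \<longrightarrow> f y = h x y"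
      using ae I(1,2) by (intro AE_ball_countable') auto
    then show ?thesis
    proof eventually_elim
      case (elim y)
      show ?case
      proof
        assume y: "y \<in> \<Omega>0"
        then obtain x where "x \<in> I" "y \<in> V x" using V(2)[OF y] \<F>(3) I(3) by blast
        with elim gh[of x y] y I(2) show "f y = g y" by auto
      qed
    qed
  qed
  ultimately show ?thesis by blast
qed

theorem mainTheorem2:
  fixes \<Omega> :: "(real^'n) set" and f :: "real^'n \<Rightarrow> real^'n"
    and Df :: "real^'n \<Rightarrow> real^'n^'n" and k :: nat and p :: real
  assumes d: "CARD('n) > 2"
    and \<Omega>: "open \<Omega>"
    and k: "2 \<le> k" "k \<le> CARD('n) - 1"
    and p: "p \<ge> 1"
    and f: "sobolev_W1p p \<Omega> f Df"
    and wedge_smooth: "\<exists>G :: real^'n \<Rightarrow> (nat \<Rightarrow> 'n) \<Rightarrow> (nat \<Rightarrow> 'n) \<Rightarrow> real.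
          (\<forall>r c. smooth_on \<Omega> (\<lambda>x. G x r c)) \<and>
          (AE x in lebesgue. x \<in> \<Omega> \<longrightarrow> (\<forall>r c. kminor k (Df x) r c = G x r c))"
    and cases: "(\<not> (even k \<and> even (CARD('n))) \<and>
                 ((AE x in lebesgue. x \<in> \<Omega> \<longrightarrow> det (Df x) > 0) \<or>
                  (AE x in lebesgue. x \<in> \<Omega> \<longrightarrow> det (Df x) < 0)))
              \<or> (odd k \<and> (AE x in lebesgue. x \<in> \<Omega> \<longrightarrow> det (Df x) \<noteq> 0))"
  shows "\<exists>\<Omega>0. open \<Omega>0 \<and> \<Omega>0 \<subseteq> \<Omega> \<and> \<Omega> - \<Omega>0 \<in> null_sets lebesgue \<and>
           (\<exists>g :: real^'n \<Rightarrow> real^'n. (\<forall>i. smooth_on \<Omega>0 (\<lambda>x. g x $ i)) \<and>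
              (AE x in lebesgue. x \<in> \<Omega>0 \<longrightarrow> f x = g x))"
proof -
  obtain G where G: "\<And>r c. smooth_on \<Omega> (\<lambda>x. G x r c)"
    and GD: "AE x in lebesgue. x \<in> \<Omega> \<longrightarrow> (\<forall>r c. kminor k (Df x) r c = G x r c)"
    using wedge_smooth by blast
  have odd: "odd k \<or> odd (CARD('n))" using cases by blast
  obtain \<epsilon> where \<epsilon>: "AE x in lebesgue. x \<in> \<Omega> \<longrightarrow> det (Df x) \<noteq> 0 \<and> (even k \<longrightarrow> sgn (det (Df x)) = \<epsilon>)"
  proof -
    consider "AE x in lebesgue. x \<in> \<Omega> \<longrightarrow> det (Df x) > 0" | "AE x in lebesgue. x \<in> \<Omega> \<longrightarrow> det (Df x) < 0"
      | "odd k" "AE x in lebesgue. x \<in> \<Omega> \<longrightarrow> det (Df x) \<noteq> 0"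
      using cases by blast
    then show ?thesis
    proof cases
      case 1
      then have "AE x in lebesgue. x \<in> \<Omega> \<longrightarrow> det (Df x) \<noteq> 0 \<and> (even k \<longrightarrow> sgn (det (Df x)) = 1)"
        by eventually_elim auto
      then show ?thesis by (rule that)
    next
      case 2
      then have "AE x in lebesgue. x \<in> \<Omega> \<longrightarrow> det (Df x) \<noteq> 0 \<and> (even k \<longrightarrow> sgn (det (Df x)) = - 1)"
        by eventually_elim auto
      then show ?thesis by (rule that)
    next
      case 3
      \<comment> \<open>\<open>k\<close> is odd here, so the clause on \<open>\<epsilon>\<close> is
        vacuous and 0 is a mere placeholder.\<close>
      from 3(2) have "AE x in lebesgue. x \<in> \<Omega> \<longrightarrow> det (Df x) \<noteq> 0 \<and> (even k \<longrightarrow> sgn (det (Df x)) = 0)"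
        by eventually_elim (use 3(1) in auto)
      then show ?thesis by (rule that)
    qed
  qed
  define good where "good x \<longleftrightarrow> kminor k (Df x) = G x \<and> det (Df x) \<noteq> 0 \<and> (even k \<longrightarrow> sgn (det (Df x)) = \<epsilon>)" for x
  have good: "AE x in lebesgue. x \<in> \<Omega> \<longrightarrow> good x"
    using GD \<epsilon> by eventually_elim (auto simp: good_def fun_eq_iff)
  \<comment> \<open>The largest candidate: openness and local versions are built in, and what
    remains is that every good point belongs to it.\<close>
  define \<Omega>0 where "\<Omega>0 = \<Union>{V. open V \<and> V \<subseteq> \<Omega> \<and> (\<exists>h :: real^'n \<Rightarrow> real^'n. (\<forall>i. smooth_on V (\<lambda>x. h x $ i)) \<and>
      (AE y in lebesgue. y \<in> V \<longrightarrow> f y = h y))}"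
  have o: "open \<Omega>0" "\<Omega>0 \<subseteq> \<Omega>" unfolding \<Omega>0_def by auto
  have "x \<in> \<Omega>0" if x: "x \<in> \<Omega>" "good x" for x
  proof -
    have k': "1 \<le> k" "k < CARD('n)" using k d by auto
    have gx: "kminor k (Df x) = G x" "det (Df x) \<noteq> 0" using x(2) by (auto simp: good_def)
    obtain W B where W: "open W" "x \<in> W" "W \<subseteq> \<Omega>" and B: "\<And>i j. smooth_on W (\<lambda>x. B x $ i $ j)"
      and eq: "\<And>x A. x \<in> W \<Longrightarrow> kminor k A = G x \<Longrightarrow> (even k \<Longrightarrow> sgn (det A) = \<epsilon>) \<Longrightarrow> A = B x"
      by (rule local_smooth_differential[OF \<Omega> x(1) k' G gx odd, of \<epsilon>]) blast
    \<comment> \<open>The centre only served to find \<open>W\<close> and \<open>B\<close>; at every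
      good point of \<open>W\<close> the matrix \<open>Df x\<close> is now determined by its
      minors.\<close>
    have "AE x in lebesgue. x \<in> W \<longrightarrow> Df x = B x"
      using good by eventually_elim (use W(3) in \<open>auto simp: good_def intro!: eq\<close>)
    from sobolev_local_smooth[OF \<Omega> p f W(1,3,2) B this]
    obtain V h where "open V" "x \<in> V" "V \<subseteq> W" "\<And>i. smooth_on V (\<lambda>x. h x $ i)"
      "AE x in lebesgue. x \<in> V \<longrightarrow> f x = h x" by blast
    then show ?thesis using W(3) unfolding \<Omega>0_def by blast
  qed
  with good have "AE x in lebesgue. x \<notin> \<Omega> - \<Omega>0"
    by (auto elim!: eventually_mono)
  moreover have "\<Omega> - \<Omega>0 \<in> sets lebesgue" using \<Omega> o(1) by (intro sets.Diff) auto
  ultimately have "\<Omega> - \<Omega>0 \<in> null_sets lebesgue" by (simp add: AE_iff_null_sets)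
  moreover have "\<exists>g :: real^'n \<Rightarrow> real^'n. (\<forall>i. smooth_on \<Omega>0 (\<lambda>x. g x $ i)) \<and>
      (AE x in lebesgue. x \<in> \<Omega>0 \<longrightarrow> f x = g x)"
    by (rule glue_local_smooth_versions[OF o(1)]) (unfold \<Omega>0_def, blast)
  ultimately show ?thesis using o by blast
qed

end
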